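(* Let $R>0$ and let $M=\mathbf X(U)\subset\mathbb R^{n+1}_1$ be a spacelike surface of codimension two (in $\mathbb R^{n+1}_1$) contained in $H_+^n(0,R)$. The following statements are equivalent: (1) there exist $r>0$ and a sign $*\in\{+,-\}$ such that $M$ is $\mathbf n_r^*$-umbilic; (2) $M$ is totally umbilic; (3) $M$ is contained in a hyperplane.
   Context: $\mathbb R^{n+1}_1$ is $\mathbb R^{n+1}$ with the pseudo scalar product $\langle \mathbf x,\mathbf y\rangle=\sum_{i=1}^n x_iy_i-x_{n+1}y_{n+1}$. For $R>0$ and a point $\mathbf a$, $H_+^n(\mathbf a,R)=\{\mathbf x:\langle\mathbf x-\mathbf a,\mathbf x-\mathbf a\rangle=-R^2,\ x_{n+1}-a_{n+1}\ge0\}$. A hyperplane is a set $HP(\mathbf n,c)=\{\mathbf x:\langle\mathbf x,\mathbf n\rangle=c\}$ with $\mathbf n\ne0$, $c\in\mathbb R$. A spacelike surface of codimension two is $M=\mathbf X(U)$, where $\mathbf X:U\to\mathbb R^{n+1}_1$ is a smooth embedding of an open domain $U\subset\mathbb R^{n-1}$ such that $\langle\cdot,\cdot\rangle$ is positive definite on every tangent space $T_pM$. The normal plane $N_pM$ (the pseudo-orthogonal complement of $T_pM$) is a timelike 2-plane, viewed as passing through the origin, and $\mathbb R^{n+1}_1=T_pM\oplus N_pM$. Let $\mathbf v=(0,\dots,0,-1)$. For $r>0$ and $p\in M$, the set $N_pM\cap H^n_+(\mathbf v,1)\cap\{x_{n+1}=r\}$ consists of exactly two points, denoted $\mathbf n_r^{\pm}(p)$;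 this gives two smooth normal vector fields $\mathbf n_r^{\pm}$ on $M$. For $*\in\{+,-\}$ the $\mathbf n_r^{*}$-Weingarten map at $p$ is $A_p^{\mathbf n_r^*}=-(d\mathbf n_r^{*}(p))^{T}:T_pM\to T_pM$, where $T$ denotes the $T_pM$-component; it is self-adjoint. $M$ is $\mathbf n_r^*$-umbilic if at every $p\in M$ all eigenvalues of $A_p^{\mathbf n_r^*}$ coincide. $M$ is totally umbilic if it is $\mathbf n_r^*$-umbilic for every $r>0$ and both signs $*$.
   Formalization: The formal theorem assumes n ≥ 3, so that M has dimension at least 2; for n = 2 the claim fails, since every spacelike curve in the hyperbolic plane is trivially umbilic but need not lie in a plane (the degenerate case n = 1, a point, is also excluded). *)

theory Defs
  imports "HOL-Analysis.Analysis"
begin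

(* The space R^(n+1)_1 is modelled as (real^'n) * real with n = CARD('n); the real component
   is the last (timelike) coordinate x_(n+1). *)

type_synonym 'n mspace = "(real^'n) \<times> real"

definition mink :: "'n::finite mspace \<Rightarrow> 'n mspace \<Rightarrow> real"
  where "mink x y = fst x \<bullet> fst y - snd x * snd y"

definition hyperbolic_plus :: "'n::finite mspace \<Rightarrow> real \<Rightarrow> 'n mspace set"
  where "hyperbolic_plus a R = {x. mink (x - a) (x - a) = - R\<^sup>2 \<and> snd x - snd a \<ge> 0}"

definition hyperplane :: "'n::finite mspace \<Rightarrow> real \<Rightarrow> 'n mspace set"
  where "hyperplane N c = {x. mink x N = c}"

fun Ck_on :: "nat \<Rightarrow> 'a::real_normed_vector set \<Rightarrow> ('a \<Rightarrow> 'b::real_normed_vector) \<Rightarrow> bool"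
  where
    "Ck_on 0 U f \<longleftrightarrow> continuous_on U f"
  | "Ck_on (Suc k) U f \<longleftrightarrow>
       (\<forall>u\<in>U. f differentiable (at u)) \<and>
       (\<forall>v. Ck_on k U (\<lambda>u. frechet_derivative f (at u) v))"

(* Meant for open U, since derivatives are taken in the full space. *)
definition smooth_on :: "'a::real_normed_vector set \<Rightarrow> ('a \<Rightarrow> 'b::real_normed_vector) \<Rightarrow> bool"
  where "smooth_on U f \<longleftrightarrow> (\<forall>k. Ck_on k U f)"

definition smooth_embedding ::
    "'a::real_normed_vector set \<Rightarrow> ('a \<Rightarrow> 'b::real_normed_vector) \<Rightarrow> bool"
  where "smooth_embedding U X \<longleftrightarrow>
    smooth_on U X \<and>
    (\<forall>u\<in>U. inj (frechet_derivative X (at u))) \<and>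
    (\<exists>g. homeomorphism U (X ` U) X g)"

(* Throughout, the surface is M = X ` U, and a point p = X u of M is addressed by its
   parameter u (X is injective on U). Accordingly a vector field n on M is represented by
   n o X, a function on U. *)

definition tangent_space ::
    "(real^'m::finite \<Rightarrow> 'n::finite mspace) \<Rightarrow> real^'m \<Rightarrow> 'n mspace set"
  where "tangent_space X u = range (frechet_derivative X (at u))"

definition normal_plane ::
    "(real^'m::finite \<Rightarrow> 'n::finite mspace) \<Rightarrow> real^'m \<Rightarrow> 'n mspace set"
  where "normal_plane X u = {x. \<forall>w\<in>tangent_space X u. mink x w = 0}"

definition spacelike_surface ::
    "(real^'m::finite) set \<Rightarrow> (real^'m \<Rightarrow> 'n::finite mspace) \<Rightarrow> bool"
  where "spacelike_surface U X \<longleftrightarrow>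
    open U \<and> connected U \<and> U \<noteq> {} \<and>
    smooth_embedding U X \<and>
    (\<forall>u\<in>U. \<forall>w\<in>tangent_space X u. w \<noteq> 0 \<longrightarrow> mink w w > 0)"

datatype sign = Plus | Minus

definition normal_section ::
    "(real^'m::finite \<Rightarrow> 'n::finite mspace) \<Rightarrow> real \<Rightarrow> real^'m \<Rightarrow> 'n mspace set"
  where "normal_section X r u =
    normal_plane X u \<inter> hyperbolic_plus (0, -1) 1 \<inter> {x. snd x = r}"

(* On a connected U the two smooth fields are determined up to interchanging them; which one
   is labelled Plus is an arbitrary choice, made separately for each r. *)
definition normal_field ::
    "(real^'m::finite) set \<Rightarrow> (real^'m \<Rightarrow> 'n::finite mspace) \<Rightarrow> real \<Rightarrow>
     sign \<Rightarrow> real^'m \<Rightarrow> 'n mspace"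
  where "normal_field U X r =
    (SOME n. (\<forall>s. smooth_on U (n s)) \<and>
             (\<forall>u\<in>U. n Plus u \<noteq> n Minus u \<and> normal_section X r u = {n Plus u, n Minus u}))"

definition tangential_part ::
    "(real^'m::finite \<Rightarrow> 'n::finite mspace) \<Rightarrow> real^'m \<Rightarrow> 'n mspace \<Rightarrow> 'n mspace"
  where "tangential_part X u x =
    (THE t. t \<in> tangent_space X u \<and> x - t \<in> normal_plane X u)"

(* For a field n on M, represented by N = n o X, the chain rule gives
   dn(p) w = dN_u ((dX_u)^(-1) w) for p = X u and w tangent to M at p.
   Only values at tangent w are meaningful. *)
definition weingarten ::
    "(real^'m::finite \<Rightarrow> 'n::finite mspace) \<Rightarrow> (real^'m \<Rightarrow> 'n mspace) \<Rightarrow> real^'m \<Rightarrow>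
     'n mspace \<Rightarrow> 'n mspace"
  where "weingarten X N u w =
    - tangential_part X u
        (frechet_derivative N (at u) (inv (frechet_derivative X (at u)) w))"

definition eigenvalue_on :: "'a::real_vector set \<Rightarrow> ('a \<Rightarrow> 'a) \<Rightarrow> real \<Rightarrow> bool"
  where "eigenvalue_on V A l \<longleftrightarrow> (\<exists>w\<in>V. w \<noteq> 0 \<and> A w = l *\<^sub>R w)"

definition umbilic ::
    "(real^'m::finite) set \<Rightarrow> (real^'m \<Rightarrow> 'n::finite mspace) \<Rightarrow> (real^'m \<Rightarrow> 'n mspace) \<Rightarrow> bool"
  where "umbilic U X N \<longleftrightarrow>
    (\<forall>u\<in>U. \<forall>l l'. eigenvalue_on (tangent_space X u) (weingarten X N u) l \<and>
                   eigenvalue_on (tangent_space X u) (weingarten X N u) l' \<longrightarrow> l = l')"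

definition totally_umbilic ::
    "(real^'m::finite) set \<Rightarrow> (real^'m \<Rightarrow> 'n::finite mspace) \<Rightarrow> bool"
  where "totally_umbilic U X \<longleftrightarrow> (\<forall>r>0. \<forall>s. umbilic U X (normal_field U X r s))"

end

theory Submission
  imports Defs
begin

text \<open>
  The position vector X is normal to the surface, and together with the unit normal E of the
  surface inside the hyperbolic space it spans every normal plane. Write D2X for the second
  derivative of X and G for the induced metric. For any normal field N, the Weingarten form of N
  is the N-component of D2X, and the X-component of D2X is -G. Since the fields n_r are spacelike,
  they have the form aX + bE with b nonzero, so each of them is umbilic if and only if E is.

  If E is umbilic, then dE = -k dX; symmetry of second derivatives forces dk = 0 because the
  surface has dimension at least 2. Hence E + kX is a constant vector N, and the product of X
  and N is the constant -k R^2. Conversely, the normal vector N of a hyperplane containing the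
  surface is a constant normal field, so its component of D2X vanishes; writing N = aX + bE shows
  that b is nonzero and that the E-component of D2X is (a/b)G.
\<close>

subsection \<open>Smooth maps\<close>

lemma has_derivative_frechet:
  "f differentiable at x \<Longrightarrow> (f has_derivative frechet_derivative f (at x)) (at x)"
  by (simp add: frechet_derivative_works)

text \<open>On an open set a derivative depends only on values inside the set, so the two functions
  have equal derivatives there and the recursion of \<open>Ck_on\<close> continues with
  those.\<close>

lemma Ck_on_cong:
  assumes "open U" "\<And>u. u \<in> U \<Longrightarrow> f u = g u" "Ck_on k U f"
  shows "Ck_on k U g"
  using assms(2,3)
proof (induction k arbitrary: f g)
  case 0
  then show ?case by (auto cong: continuous_on_cong)
next
  case (Suc k)
  have *: "(g has_derivative frechet_derivative f (at u)) (at u)" if "u \<in> U" for u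
    by (rule has_derivative_transform_within_open[of f _ u UNIV U])
       (use Suc.prems that assms(1) has_derivative_frechet in auto)
  then have D: "frechet_derivative g (at u) = frechet_derivative f (at u)" if "u \<in> U" for u
    using that by (metis frechet_derivative_at)
  have "Ck_on k U (\<lambda>u. frechet_derivative g (at u) v)" for v
    by (rule Suc.IH[of "\<lambda>u. frechet_derivative f (at u) v"]) (use Suc.prems D in auto)
  then show ?case using * by (auto simp: differentiable_def)
qed

text \<open>By uniqueness of derivatives any explicit formula may replace
  \<open>frechet_derivative\<close>; the closure rules below raise the order through this.\<close>

lemma Ck_on_SucI:
  assumes "open U" "\<And>u. u \<in> U \<Longrightarrow> (f has_derivative f' u) (at u)"
    and "\<And>v. Ck_on k U (\<lambda>u. f' u v)"
  shows "Ck_on (Suc k) U f"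
proof -
  have "Ck_on k U (\<lambda>u. frechet_derivative f (at u) v)" for v
    by (rule Ck_on_cong[OF assms(1) _ assms(3)[of v]]) (metis assms(2) frechet_derivative_at)
  then show ?thesis using assms(2) by (auto simp: differentiable_def)
qed

lemma Ck_on_SucD:
  assumes "Ck_on (Suc k) U f"
  shows "u \<in> U \<Longrightarrow> (f has_derivative frechet_derivative f (at u)) (at u)"
    and "Ck_on k U (\<lambda>u. frechet_derivative f (at u) v)"
    and "Ck_on k U f"
proof -
  show "u \<in> U \<Longrightarrow> (f has_derivative frechet_derivative f (at u)) (at u)"
    and "Ck_on k U (\<lambda>u. frechet_derivative f (at u) v)"
    using assms by (auto intro: has_derivative_frechet)
  show "Ck_on k U f" using assms
  proof (induction k arbitrary: f)
    case 0
    then show ?case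
      by (auto intro!: continuous_at_imp_continuous_on differentiable_imp_continuous_within)
  qed auto
qed

lemma Ck_on_const: "open U \<Longrightarrow> Ck_on k U (\<lambda>u. c)"
  by (induction k arbitrary: c) auto

lemma Ck_on_linear:
  assumes "open U" "bounded_linear L" "Ck_on k U f"
  shows "Ck_on k U (\<lambda>u. L (f u))"
  using assms(3)
proof (induction k arbitrary: f)
  case 0
  then show ?case using assms(2)
    by (auto intro: bounded_linear.continuous_on)
next
  case (Suc k)
  show ?case
    by (rule Ck_on_SucI[OF assms(1) bounded_linear.has_derivative[OF assms(2) Ck_on_SucD(1)[OF Suc.prems]]])
       (use Suc.IH[OF Ck_on_SucD(2)[OF Suc.prems]] in auto)
qed

lemma Ck_on_add:
  assumes "open U" "Ck_on k U f" "Ck_on k U g"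
  shows "Ck_on k U (\<lambda>u. f u + g u)"
  using assms(2,3)
proof (induction k arbitrary: f g)
  case (Suc k)
  show ?case
    by (rule Ck_on_SucI[OF assms(1) has_derivative_add[OF Ck_on_SucD(1)[OF Suc.prems(1)] Ck_on_SucD(1)[OF Suc.prems(2)]]])
       (use Suc.IH[OF Ck_on_SucD(2)[OF Suc.prems(1)] Ck_on_SucD(2)[OF Suc.prems(2)]] in auto)
qed (auto intro: continuous_intros)

text \<open>The product rule gives two terms, each bilinear in one function and a derivative of the
  other, all of order \<open>k\<close>. The single statement serves products, scalings, inner
  products and \<open>mink\<close>.\<close>

lemma Ck_on_bilinear:
  assumes "open U" "bounded_bilinear p" "Ck_on k U f" "Ck_on k U g"
  shows "Ck_on k U (\<lambda>u. p (f u) (g u))"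
  using assms(3,4)
proof (induction k arbitrary: f g)
  case 0
  then show ?case using assms(2) by (auto intro: bounded_bilinear.continuous_on)
next
  case (Suc k)
  note f = Ck_on_SucD[OF Suc.prems(1)] and g = Ck_on_SucD[OF Suc.prems(2)]
  show ?case
    by (rule Ck_on_SucI[OF assms(1) bounded_bilinear.FDERIV[OF assms(2) f(1) g(1)]])
       (auto intro!: Ck_on_add Suc.IH f g assms(1))
qed

text \<open>The derivative contains \<open>inverse (f u)\<close> again, but only its regularity of
  order \<open>k\<close> is required, which the induction hypothesis supplies. The square root is
  treated the same way.\<close>

lemma Ck_on_inverse:
  fixes f :: "_ \<Rightarrow> real"
  assumes "open U" "\<And>u. u \<in> U \<Longrightarrow> f u \<noteq> 0" "Ck_on k U f"
  shows "Ck_on k U (\<lambda>u. inverse (f u))"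
  using assms(3)
proof (induction k)
  case 0
  then show ?case using assms(2) by (auto intro: continuous_intros)
next
  case (Suc k)
  note f = Ck_on_SucD[OF Suc.prems]
  have "Ck_on k U (\<lambda>u. - (inverse (f u) * frechet_derivative f (at u) v * inverse (f u)))" for v
    by (intro Ck_on_linear[OF assms(1) bounded_linear_minus[OF bounded_linear_ident]]
        Ck_on_bilinear[OF assms(1) bounded_bilinear_mult] Suc.IH f)
  then show ?case
    by (intro Ck_on_SucI[OF assms(1) Deriv.has_derivative_inverse[OF assms(2) f(1)]]) auto
qed

lemma Ck_on_sqrt:
  assumes "open U" "\<And>u. u \<in> U \<Longrightarrow> f u > 0" "Ck_on k U f"
  shows "Ck_on k U (\<lambda>u. sqrt (f u))"
  using assms(3)
proof (induction k)
  case 0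
  then show ?case by (auto intro: continuous_intros)
next
  case (Suc k)
  note f = Ck_on_SucD[OF Suc.prems]
  have "Ck_on k U (\<lambda>u. frechet_derivative f (at u) v * inverse (sqrt (f u)) * (1/2))" for v
    by (intro Ck_on_bilinear[OF assms(1) bounded_bilinear_mult] Ck_on_inverse Ck_on_const Suc.IH f assms(1))
       (use assms(2) in force)
  moreover have "((\<lambda>u. sqrt (f u)) has_derivative
      (\<lambda>v. frechet_derivative f (at u) v * inverse (sqrt (f u)) * (1/2))) (at u)" if "u \<in> U" for u
    using f(1)[OF that] assms(2)[OF that]
    by (auto intro!: derivative_eq_intros simp: field_simps)
  ultimately show ?case
    by (rule Ck_on_SucI[OF assms(1), rotated])
qed

context
  fixes U :: "'a::real_normed_vector set"
  assumes U: "open U"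
begin

lemma smooth_on_const: "smooth_on U (\<lambda>u. c)"
  by (simp add: smooth_on_def Ck_on_const U)

lemma smooth_on_linear: "bounded_linear L \<Longrightarrow> smooth_on U f \<Longrightarrow> smooth_on U (\<lambda>u. L (f u))"
  by (simp add: smooth_on_def Ck_on_linear U)

lemma smooth_on_minus: "smooth_on U f \<Longrightarrow> smooth_on U (\<lambda>u. - f u)"
  by (rule smooth_on_linear[OF bounded_linear_minus[OF bounded_linear_ident]])

lemma smooth_on_add: "smooth_on U f \<Longrightarrow> smooth_on U g \<Longrightarrow> smooth_on U (\<lambda>u. f u + g u)"
  by (simp add: smooth_on_def Ck_on_add U)

lemma smooth_on_diff: "smooth_on U f \<Longrightarrow> smooth_on U g \<Longrightarrow> smooth_on U (\<lambda>u. f u - g u)"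
  using smooth_on_add[of f "\<lambda>u. - g u"] smooth_on_minus[of g] by simp

lemma smooth_on_bilinear:
  "bounded_bilinear p \<Longrightarrow> smooth_on U f \<Longrightarrow> smooth_on U g \<Longrightarrow> smooth_on U (\<lambda>u. p (f u) (g u))"
  by (simp add: smooth_on_def Ck_on_bilinear U)

lemmas smooth_on_mult = smooth_on_bilinear[OF bounded_bilinear_mult]
  and smooth_on_scaleR = smooth_on_bilinear[OF bounded_bilinear_scaleR]
  and smooth_on_inner = smooth_on_bilinear[OF bounded_bilinear_inner]

lemma smooth_on_inverse:
  fixes f :: "'a \<Rightarrow> real"
  shows "smooth_on U f \<Longrightarrow> (\<And>u. u \<in> U \<Longrightarrow> f u \<noteq> 0) \<Longrightarrow> smooth_on U (\<lambda>u. inverse (f u))"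
  by (simp add: smooth_on_def Ck_on_inverse U)

lemma smooth_on_divide:
  fixes f :: "'a \<Rightarrow> real"
  shows "smooth_on U f \<Longrightarrow> smooth_on U g \<Longrightarrow> (\<And>u. u \<in> U \<Longrightarrow> g u \<noteq> 0) \<Longrightarrow> smooth_on U (\<lambda>u. f u / g u)"
  using smooth_on_mult[of f "\<lambda>u. inverse (g u)"] smooth_on_inverse[of g] by (simp add: divide_inverse)

lemma smooth_on_sqrt:
  "smooth_on U f \<Longrightarrow> (\<And>u. u \<in> U \<Longrightarrow> f u > 0) \<Longrightarrow> smooth_on U (\<lambda>u. sqrt (f u))"
  by (simp add: smooth_on_def Ck_on_sqrt U)

lemma smooth_on_sum:
  "finite I \<Longrightarrow> (\<And>i. i \<in> I \<Longrightarrow> smooth_on U (f i)) \<Longrightarrow> smooth_on U (\<lambda>u. \<Sum>i\<in>I. f i u)"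
  by (induction I rule: finite_induct) (auto intro: smooth_on_const smooth_on_add)

lemma smooth_on_prod:
  fixes f :: "_ \<Rightarrow> 'a \<Rightarrow> real"
  shows "finite I \<Longrightarrow> (\<And>i. i \<in> I \<Longrightarrow> smooth_on U (f i)) \<Longrightarrow> smooth_on U (\<lambda>u. \<Prod>i\<in>I. f i u)"
  by (induction I rule: finite_induct) (auto intro: smooth_on_const smooth_on_mult)

end

lemma smooth_on_has_derivative:
  "smooth_on U f \<Longrightarrow> u \<in> U \<Longrightarrow> (f has_derivative frechet_derivative f (at u)) (at u)"
  unfolding smooth_on_def by (meson Ck_on_SucD(1))

lemma smooth_on_frechet_derivative:
  "smooth_on U f \<Longrightarrow> smooth_on U (\<lambda>u. frechet_derivative f (at u) v)"
  unfolding smooth_on_def using Ck_on_SucD(2) by blast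

lemma smooth_on_continuous_on: "smooth_on U f \<Longrightarrow> continuous_on U f"
  unfolding smooth_on_def by (metis Ck_on.simps(1))

subsection \<open>Symmetry of second derivatives\<close>

text \<open>The one-dimensional mean value theorem is applied twice: along \<open>x\<close> to the
  difference \<open>\<phi>\<close> of \<open>f\<close> across the side \<open>h *\<^sub>R y\<close>,
  then along \<open>y\<close> to the derivative in direction \<open>x\<close>.\<close>

lemma second_difference_mvt:
  fixes f :: "'a::real_normed_vector \<Rightarrow> real"
  assumes "h > 0"
    and f': "\<And>s t. \<lbrakk>0 \<le> s; s \<le> h; 0 \<le> t; t \<le> h\<rbrakk> \<Longrightarrow>
      (f has_derivative f' (u + s *\<^sub>R x + t *\<^sub>R y)) (at (u + s *\<^sub>R x + t *\<^sub>R y))"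
    and A': "\<And>s t. \<lbrakk>0 \<le> s; s \<le> h; 0 \<le> t; t \<le> h\<rbrakk> \<Longrightarrow>
      ((\<lambda>z. f' z x) has_derivative A' (u + s *\<^sub>R x + t *\<^sub>R y)) (at (u + s *\<^sub>R x + t *\<^sub>R y))"
  shows "\<exists>s t. 0 < s \<and> s < h \<and> 0 < t \<and> t < h \<and>
    f (u + h *\<^sub>R x + h *\<^sub>R y) - f (u + h *\<^sub>R x) - f (u + h *\<^sub>R y) + f u
      = h\<^sup>2 * A' (u + s *\<^sub>R x + t *\<^sub>R y) y"
proof -
  define \<phi> where "\<phi> s = f (u + s *\<^sub>R x + h *\<^sub>R y) - f (u + s *\<^sub>R x)" for s
  have line: "((\<lambda>s. g (u + s *\<^sub>R x + t *\<^sub>R y)) has_real_derivative g' x) (at s)"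
    if "(g has_derivative g') (at (u + s *\<^sub>R x + t *\<^sub>R y))" for g :: "'a \<Rightarrow> real" and g' u s t x y
  proof -
    have "((\<lambda>s. u + s *\<^sub>R x + t *\<^sub>R y) has_derivative (\<lambda>s. s *\<^sub>R x)) (at s)"
      by (auto intro!: derivative_eq_intros)
    from has_derivative_compose[OF this that]
    have "((\<lambda>s. g (u + s *\<^sub>R x + t *\<^sub>R y)) has_derivative (\<lambda>s. g' (s *\<^sub>R x))) (at s)" .
    then show ?thesis
      using linear_scale[OF has_derivative_linear[OF that]]
      by (simp add: has_field_derivative_def mult_commute_abs)
  qed
  have "(\<phi> has_real_derivative (f' (u + s *\<^sub>R x + h *\<^sub>R y) x - f' (u + s *\<^sub>R x) x)) (at s)"
    if "0 \<le> s" "s \<le> h" for s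
    unfolding \<phi>_def using line[OF f'[of s h]] line[OF f'[of s 0]] that \<open>h > 0\<close>
    by (auto intro!: derivative_intros)
  from MVT2[OF \<open>h > 0\<close> this] obtain s where s: "0 < s" "s < h"
    "\<phi> h - \<phi> 0 = h * (f' (u + s *\<^sub>R x + h *\<^sub>R y) x - f' (u + s *\<^sub>R x) x)" by auto
  have "((\<lambda>t. f' (u + s *\<^sub>R x + t *\<^sub>R y) x) has_real_derivative A' (u + s *\<^sub>R x + t *\<^sub>R y) y) (at t)"
    if "0 \<le> t" "t \<le> h" for t
    using line[of "\<lambda>z. f' z x" "A' (u + s *\<^sub>R x + t *\<^sub>R y)" u t y s x] A'[of s t] that s
    by (simp add: add_ac)
  from MVT2[OF \<open>h > 0\<close> this] obtain t where t: "0 < t" "t < h"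
    "f' (u + s *\<^sub>R x + h *\<^sub>R y) x - f' (u + s *\<^sub>R x) x = h * A' (u + s *\<^sub>R x + t *\<^sub>R y) y" by auto
  show ?thesis
    using s t by (intro exI[of _ s] exI[of _ t]) (auto simp: \<phi>_def power2_eq_square)
qed

text \<open>The second difference over a parallelogram is symmetric in \<open>x\<close> and
  \<open>y\<close>, so the two mixed derivatives share a value at some pair of points near
  \<open>u\<close>. Continuity excludes this if they differ at \<open>u\<close>.\<close>

lemma symmetric_second_derivative_real:
  fixes f :: "'a::real_normed_vector \<Rightarrow> real"
  assumes U: "open U" "u \<in> U" and f: "smooth_on U f"
  shows "frechet_derivative (\<lambda>u. frechet_derivative f (at u) x) (at u) y
       = frechet_derivative (\<lambda>u. frechet_derivative f (at u) y) (at u) x"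
    (is "?A x y u = ?A y x u")
proof (rule ccontr)
  assume ne: "?A x y u \<noteq> ?A y x u"
  \<comment> \<open>Half the gap: two numbers closer than \<open>e\<close> to the respective values
    at \<open>u\<close> cannot coincide.\<close>
  define e where "e = \<bar>?A x y u - ?A y x u\<bar> / 2"
  have "e > 0" using ne by (simp add: e_def)
  have "continuous (at u) (?A x y)" "continuous (at u) (?A y x)"
    using smooth_on_continuous_on[OF smooth_on_frechet_derivative[OF smooth_on_frechet_derivative[OF f]]] U
    by (auto simp: continuous_on_eq_continuous_at)
  then obtain d1 d2 where d: "d1 > 0" "d2 > 0"
    "\<And>z. dist z u < d1 \<Longrightarrow> \<bar>?A x y z - ?A x y u\<bar> < e"
    "\<And>z. dist z u < d2 \<Longrightarrow> \<bar>?A y x z - ?A y x u\<bar> < e"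
    using \<open>e > 0\<close> unfolding continuous_at_eps_delta dist_real_def by metis
  obtain d3 where d3: "d3 > 0" "ball u d3 \<subseteq> U" using U openE by blast
  define d where "d = min d3 (min d1 d2)"
  \<comment> \<open>The whole parallelogram with sides \<open>h *\<^sub>R x\<close> and
    \<open>h *\<^sub>R y\<close> then stays within \<open>d / 2\<close> of \<open>u\<close>; the
    summand 1 keeps the denominator positive even for zero directions.\<close>
  define h where "h = d / (2 * (norm x + norm y + 1))"
  have np: "norm x + norm y + 1 > 0" by (smt (verit) norm_ge_zero)
  have "d > 0" using d d3 by (simp add: d_def)
  then have "h > 0" using np by (simp add: h_def)
  have near: "dist (u + s *\<^sub>R x + t *\<^sub>R y) u < d" if "0 \<le> s" "s \<le> h" "0 \<le> t" "t \<le> h" for s t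
  proof -
    have "dist (u + s *\<^sub>R x + t *\<^sub>R y) u \<le> s * norm x + t * norm y"
      using that norm_triangle_ineq[of "s *\<^sub>R x" "t *\<^sub>R y"] by (simp add: dist_norm)
    also have "\<dots> \<le> h * norm x + h * norm y"
      using that by (intro add_mono mult_right_mono) auto
    also have "\<dots> \<le> h * (norm x + norm y + 1)"
      using \<open>h > 0\<close> by (simp add: algebra_simps)
    also have "\<dots> = d / 2" proof -
      have "h * (2 * (norm x + norm y + 1)) = d"
        unfolding h_def using np by (intro nonzero_eq_divide_eq[THEN iffD1]) auto
      then show ?thesis by (simp add: algebra_simps)
    qed
    finally show ?thesis using \<open>d > 0\<close> by simp
  qed
  have inU: "u + s *\<^sub>R x + t *\<^sub>R y \<in> U" if "0 \<le> s" "s \<le> h" "0 \<le> t" "t \<le> h" for s t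
    using near[OF that] d3 by (auto simp: d_def dist_commute subset_eq)
  note D = smooth_on_has_derivative[OF f] smooth_on_has_derivative[OF smooth_on_frechet_derivative[OF f]]
  obtain s t where st: "0 < s" "s < h" "0 < t" "t < h"
    "f (u + h *\<^sub>R x + h *\<^sub>R y) - f (u + h *\<^sub>R x) - f (u + h *\<^sub>R y) + f u
      = h\<^sup>2 * ?A x y (u + s *\<^sub>R x + t *\<^sub>R y)"
    using second_difference_mvt[OF \<open>h > 0\<close> D(1)[OF inU] D(2)[OF inU]] by blast
  have inU': "u + s *\<^sub>R y + t *\<^sub>R x \<in> U" if "0 \<le> s" "s \<le> h" "0 \<le> t" "t \<le> h" for s t
    using inU[of t s] that by (simp add: add_ac)
  \<comment> \<open>The same second difference with \<open>x\<close> and \<open>y\<close> exchanged,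
    so the first witness is the coefficient of \<open>y\<close>.\<close>
  obtain t' s' where st': "0 < s'" "s' < h" "0 < t'" "t' < h"
    "f (u + h *\<^sub>R y + h *\<^sub>R x) - f (u + h *\<^sub>R y) - f (u + h *\<^sub>R x) + f u
      = h\<^sup>2 * ?A y x (u + t' *\<^sub>R y + s' *\<^sub>R x)"
    using second_difference_mvt[OF \<open>h > 0\<close> D(1)[OF inU'] D(2)[OF inU']] by blast
  have "h\<^sup>2 * ?A x y (u + s *\<^sub>R x + t *\<^sub>R y) = h\<^sup>2 * ?A y x (u + s' *\<^sub>R x + t' *\<^sub>R y)"
    using st(5) st'(5) by (simp add: algebra_simps)
  then have eq: "?A x y (u + s *\<^sub>R x + t *\<^sub>R y) = ?A y x (u + s' *\<^sub>R x + t' *\<^sub>R y)"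
    using \<open>h > 0\<close> by simp
  have "\<bar>?A x y (u + s *\<^sub>R x + t *\<^sub>R y) - ?A x y u\<bar> < e"
    "\<bar>?A y x (u + s' *\<^sub>R x + t' *\<^sub>R y) - ?A y x u\<bar> < e"
    using d(3,4) near st st' by (simp_all add: d_def)
  moreover have False if "\<bar>a - b\<bar> < \<bar>b - c\<bar> / 2" "\<bar>a - c\<bar> < \<bar>b - c\<bar> / 2" for a b c :: real
    using that by (auto simp: abs_if split: if_splits)
  ultimately show False unfolding eq e_def by blast
qed

text \<open>Reduction to the real case: taking the inner product with a basis vector commutes with
  both differentiations.\<close>

lemma symmetric_second_derivative:
  fixes f :: "'a::real_normed_vector \<Rightarrow> 'b::euclidean_space"
  assumes U: "open U" "u \<in> U" and f: "smooth_on U f"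
  shows "frechet_derivative (\<lambda>u. frechet_derivative f (at u) x) (at u) y
       = frechet_derivative (\<lambda>u. frechet_derivative f (at u) y) (at u) x"
proof (rule euclidean_eqI)
  fix b :: 'b
  let ?g = "\<lambda>u. f u \<bullet> b"
  have sg: "smooth_on U ?g"
    by (rule smooth_on_linear[OF U(1) bounded_linear_inner_left f])
  have Dg: "frechet_derivative (\<lambda>u. g u \<bullet> b) (at z) v = frechet_derivative g (at z) v \<bullet> b"
    if "smooth_on U g" "z \<in> U" for g z v
    by (metis that smooth_on_has_derivative frechet_derivative_at
        bounded_linear.has_derivative[OF bounded_linear_inner_left])
  have "frechet_derivative (\<lambda>u. frechet_derivative f (at u) v) (at u) w \<bullet> b
      = frechet_derivative (\<lambda>u. frechet_derivative ?g (at u) v) (at u) w" for v w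
  proof -
    have 1: "(\<lambda>u. frechet_derivative f (at u) v \<bullet> b) differentiable at u"
      using smooth_on_has_derivative[OF smooth_on_linear[OF U(1) bounded_linear_inner_left
          smooth_on_frechet_derivative[OF f]] U(2)] by (auto simp: differentiable_def)
    have "frechet_derivative (\<lambda>u. frechet_derivative f (at u) v \<bullet> b) (at u)
        = frechet_derivative (\<lambda>u. frechet_derivative ?g (at u) v) (at u)"
      by (rule frechet_derivative_transform_within_open[OF 1 U]) (simp add: Dg[OF f])
    then show ?thesis using Dg[OF smooth_on_frechet_derivative[OF f] U(2)] by metis
  qed
  then show "frechet_derivative (\<lambda>u. frechet_derivative f (at u) x) (at u) y \<bullet> b
       = frechet_derivative (\<lambda>u. frechet_derivative f (at u) y) (at u) x \<bullet> b"
    using symmetric_second_derivative_real[OF U sg] by simp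
qed

subsection \<open>The generalised cross product\<close>

text \<open>
  The cross product of the \<open>n - 1\<close> vectors \<open>V i\<close>, \<open>i \<noteq> k\<close>. Applied to the spatial parts of the
  coordinate tangent vectors it gives a globally defined smooth normal field, so that the two
  normals \<open>n_r\<close> can be chosen smoothly on all of \<open>U\<close>, even if \<open>U\<close> is not simply connected.
\<close>

definition cross_rows :: "'n::finite \<Rightarrow> ('n \<Rightarrow> real^'n) \<Rightarrow> real^'n"
  where "cross_rows k V = (\<chi> j. det (\<chi> i. if i = k then axis j 1 else V i))"

text \<open>The determinant is linear in row \<open>k\<close>, so it can be expanded along the
  coordinates of \<open>w\<close>.\<close>

lemma inner_cross_rows: "cross_rows k V \<bullet> w = det (\<chi> i. if i = k then w else V i)"
proof -
  let ?f = "\<lambda>w. det (\<chi> i. if i = k then w else V i)"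
  have lin: "linear ?f"
  proof (rule linearI)
    show "?f (x + y) = ?f x + ?f y" for x y
      by (rule det_row_add[where a = "\<lambda>_. x" and b = "\<lambda>_. y"])
    show "?f (c *\<^sub>R x) = c *\<^sub>R ?f x" for c x
      using det_row_mul[of k c "\<lambda>_. x" V] unfolding scalar_mult_eq_scaleR by simp
  qed
  have "?f w = ?f (\<Sum>j\<in>UNIV. w $ j *\<^sub>R axis j 1)"
    using basis_expansion[of w] by (simp only: scalar_mult_eq_scaleR)
  also have "\<dots> = (\<Sum>j\<in>UNIV. w $ j * ?f (axis j 1))"
    by (simp add: linear_sum[OF lin] linear_scale[OF lin])
  finally show ?thesis
    by (simp add: cross_rows_def inner_vec_def mult.commute)
qed

lemma cross_rows_orthogonal:
  assumes "i \<noteq> k"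
  shows "cross_rows k V \<bullet> V i = 0"
  unfolding inner_cross_rows
  by (rule det_identical_rows[of i k]) (use assms in \<open>auto simp: row_def vec_eq_iff\<close>)

text \<open>Fewer vectors than the dimension leave room for some \<open>w \<noteq> 0\<close>
  orthogonal to all of them. Placed in row \<open>k\<close> it completes an invertible matrix, whose
  determinant is the inner product of the cross product with \<open>w\<close>. The hypothesis
  expresses independence of the indexed family, so repeated vectors count as dependent.\<close>

lemma cross_rows_nonzero:
  fixes V :: "'n::finite \<Rightarrow> real^'n"
  assumes indep: "\<And>c. (\<Sum>i\<in>UNIV - {k}. c i *\<^sub>R V i) = 0 \<Longrightarrow> \<forall>i. i \<noteq> k \<longrightarrow> c i = 0"
  shows "cross_rows k V \<noteq> 0"
proof -
  let ?W = "V ` (UNIV - {k})"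
  have "dim ?W \<le> card (UNIV - {k})"
    by (meson card_image_le dim_le_card' finite finite_imageI le_trans)
  also have "\<dots> < DIM(real^'n)"
    by (simp add: card_Diff_singleton card_gt_0_iff)
  finally have "dim ?W < DIM(real^'n)" .
  then obtain w where w: "w \<noteq> 0" "\<And>v. v \<in> span ?W \<Longrightarrow> orthogonal w v"
    using orthogonal_to_subspace_exists by blast
  have wV: "w \<bullet> V i = 0" if "i \<noteq> k" for i
    using w(2)[of "V i"] that by (auto simp: orthogonal_def intro: span_base)
  let ?A = "(\<chi> i. if i = k then w else V i) :: real^'n^'n"
  have "\<forall>i. c i = 0" if "(\<Sum>i\<in>UNIV. c i *s row i ?A) = 0" for c
  proof -
    have "(\<Sum>i\<in>UNIV. c i *s row i ?A) = c k *\<^sub>R w + (\<Sum>i\<in>UNIV - {k}. c i *\<^sub>R V i)"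
      by (subst sum.remove[of _ k]) (auto simp: row_def vec_eq_iff intro!: sum.cong)
    then have eq: "c k *\<^sub>R w + (\<Sum>i\<in>UNIV - {k}. c i *\<^sub>R V i) = 0" using that by simp
    then have "w \<bullet> (c k *\<^sub>R w + (\<Sum>i\<in>UNIV - {k}. c i *\<^sub>R V i)) = 0" by simp
    then have "c k = 0"
      using w(1) wV by (simp add: inner_add_right inner_sum_right)
    moreover from this eq have "(\<Sum>i\<in>UNIV - {k}. c i *\<^sub>R V i) = 0" by simp
    then have "\<forall>i. i \<noteq> k \<longrightarrow> c i = 0" by (rule indep)
    ultimately show ?thesis by metis
  qed
  then have "det ?A \<noteq> 0"
    unfolding invertible_det_nz[symmetric] invertible_right_inverse
      matrix_right_invertible_independent_rows by blast
  then show ?thesis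
    using inner_cross_rows[of k V w] by auto
qed

text \<open>Each component is a polynomial in the entries by the permutation formula; the vector is
  then reassembled from its components as a finite sum.\<close>

lemma smooth_on_cross_rows:
  assumes U: "open U" and V: "\<And>i. smooth_on U (\<lambda>u. V u i)"
  shows "smooth_on U (\<lambda>u. cross_rows k (V u))"
proof -
  have entry: "smooth_on U (\<lambda>u. (if i = k then axis j 1 else V u i) $ l)" for i j l
    using smooth_on_linear[OF U bounded_linear_vec_nth V[of i], of l] smooth_on_const[OF U]
    by (cases "i = k") auto
  have "smooth_on U (\<lambda>u. det (\<chi> i. if i = k then axis j 1 else V u i))" for j
    unfolding det_def
    by (simp, intro smooth_on_sum[OF U] smooth_on_mult[OF U] smooth_on_prod[OF U]
        smooth_on_const[OF U] entry finite_permutations) auto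
  then have "smooth_on U (\<lambda>u. \<Sum>j\<in>UNIV. det (\<chi> i. if i = k then axis j 1 else V u i) *\<^sub>R axis j (1::real))"
    by (intro smooth_on_sum[OF U] smooth_on_scaleR[OF U] smooth_on_const[OF U]) auto
  moreover have "(\<Sum>j\<in>UNIV. det (\<chi> i. if i = k then axis j 1 else V u i) *\<^sub>R axis j (1::real))
      = cross_rows k (V u)" for u
    using basis_expansion[of "cross_rows k (V u)"]
    by (simp add: cross_rows_def scalar_mult_eq_scaleR)
  ultimately show ?thesis by simp
qed

subsection \<open>Symmetric forms with a single eigenvalue\<close>

text \<open>The Rayleigh quotient of \<open>B\<close> relative to \<open>G\<close> attains its
  minimum \<open>l\<close> on the compact unit sphere. Then \<open>B - l G\<close> is positive
  semidefinite and vanishes on the minimiser, and a null vector of a semidefinite form pairs to zero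
  with everything.\<close>

lemma exists_rayleigh_minimum:
  fixes B G :: "'a::euclidean_space \<Rightarrow> 'a \<Rightarrow> real"
  assumes B: "bilinear B" "\<And>x y. B x y = B y x"
    and G: "bilinear G" "\<And>x y. G x y = G y x" "\<And>x. x \<noteq> 0 \<Longrightarrow> G x x > 0"
  obtains l x where "x \<noteq> 0" "\<And>y. B x y = l * G x y" "\<And>y. l * G y y \<le> B y y"
proof -
  let ?q = "\<lambda>x. B x x / G x x"
  have cont: "continuous_on (sphere 0 1) (\<lambda>x. b x x)" if "bilinear b" for b :: "'a \<Rightarrow> 'a \<Rightarrow> real"
    using that bounded_bilinear.continuous_on[OF _ continuous_on_id continuous_on_id]
    by (simp add: bilinear_conv_bounded_bilinear)
  have "continuous_on (sphere 0 1) ?q"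
  proof (intro continuous_on_divide ballI cont[OF B(1)] cont[OF G(1)])
    show "G x x \<noteq> 0" if "x \<in> sphere 0 1" for x
      using G(3)[of x] that by fastforce
  qed
  moreover have "sphere (0::'a) 1 \<noteq> {}" by simp
  ultimately obtain x where x: "x \<in> sphere 0 1" "\<And>y. y \<in> sphere 0 1 \<Longrightarrow> ?q x \<le> ?q y"
    using continuous_attains_inf[OF compact_sphere] by blast
  define l where "l = ?q x"
  have x0: "x \<noteq> 0" using x(1) by auto
  have sc: "b (c *\<^sub>R y) (c *\<^sub>R y) = c\<^sup>2 * b y y" if "bilinear b" for b :: "'a \<Rightarrow> 'a \<Rightarrow> real" and c y
    by (simp add: bilinear_lmul[OF that] bilinear_rmul[OF that] power2_eq_square)
  have min: "l * G y y \<le> B y y" for y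
  proof (cases "y = 0")
    case True
    then show ?thesis by (simp add: bilinear_lzero[OF B(1)] bilinear_lzero[OF G(1)])
  next
    case False
    let ?c = "inverse (norm y)"
    have "l \<le> ?q (?c *\<^sub>R y)"
      unfolding l_def using False by (intro x(2)) simp
    also have "\<dots> = ?q y"
      using False by (simp only: sc[OF B(1)] sc[OF G(1)]) simp
    finally show ?thesis using G(3)[OF False] by (simp add: field_simps)
  qed
  define F where "F y z = B y z - l * G y z" for y z
  have Fx: "F x x = 0" using G(3)[OF x0] by (simp add: F_def l_def)
  have Fpos: "F y y \<ge> 0" for y using min[of y] by (simp add: F_def)
  have "F x y = 0" for y
  proof (rule ccontr)
    assume ne: "F x y \<noteq> 0"
    have F2: "F (t *\<^sub>R x + y) (t *\<^sub>R x + y) = t\<^sup>2 * F x x + 2 * t * F x y + F y y" for t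
      by (simp add: F_def bilinear_ladd[OF B(1)] bilinear_radd[OF B(1)] bilinear_ladd[OF G(1)]
          bilinear_radd[OF G(1)] bilinear_lmul[OF B(1)] bilinear_rmul[OF B(1)] bilinear_lmul[OF G(1)]
          bilinear_rmul[OF G(1)] B(2)[of y x] G(2)[of y x] power2_eq_square algebra_simps)
    \<comment> \<open>As \<open>F x x = 0\<close>, the value of \<open>F\<close> on the diagonal at
      \<open>t *\<^sub>R x + y\<close> is affine in \<open>t\<close>; this \<open>t\<close> makes it
      -1.\<close>
    define t where "t = - (F y y + 1) / (2 * F x y)"
    have "2 * t * F x y + F y y = -1" using ne by (simp add: t_def field_simps)
    then have "F (t *\<^sub>R x + y) (t *\<^sub>R x + y) = -1" using F2[of t] Fx by simp
    then show False using Fpos[of "t *\<^sub>R x + y"] by simp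
  qed
  then show ?thesis using that[OF x0, of l] min by (simp add: F_def)
qed

text \<open>Minimising the quotients of \<open>B\<close> and of \<open>- B\<close> gives the
  smallest relative eigenvalue \<open>l\<close> and the largest one \<open>- l'\<close>. When they
  agree the quadratic forms are proportional, and polarisation extends this to the bilinear
  forms.\<close>

lemma symmetric_bilinear_single_eigenvalue:
  fixes B G :: "'a::euclidean_space \<Rightarrow> 'a \<Rightarrow> real"
  assumes B: "bilinear B" "\<And>x y. B x y = B y x"
    and G: "bilinear G" "\<And>x y. G x y = G y x" "\<And>x. x \<noteq> 0 \<Longrightarrow> G x x > 0"
    and single: "\<And>l l' x x'. x \<noteq> 0 \<Longrightarrow> x' \<noteq> 0 \<Longrightarrow> (\<And>y. B x y = l * G x y) \<Longrightarrow>
      (\<And>y. B x' y = l' * G x' y) \<Longrightarrow> l = l'"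
  obtains l where "\<And>x y. B x y = l * G x y"
proof -
  obtain l x where l: "x \<noteq> 0" "\<And>y. B x y = l * G x y" "\<And>y. l * G y y \<le> B y y"
    using exists_rayleigh_minimum[OF B G] by metis
  have nB: "bilinear (\<lambda>x y. - B x y)" "\<And>x y. - B x y = - B y x"
    using B by (auto simp: bilinear_def linear_compose_neg)
  obtain l' x' where l': "x' \<noteq> 0" "\<And>y. - B x' y = l' * G x' y" "\<And>y. l' * G y y \<le> - B y y"
    using exists_rayleigh_minimum[OF nB G] by metis
  have "B x' y = - l' * G x' y" for y using l'(2)[of y] by simp
  then have "l = - l'" using single l l' by blast
  then have diag: "B y y = l * G y y" for y using l(3)[of y] l'(3)[of y] by simp
  have "B x y = l * G x y" for x y
    using diag[of "x + y"] diag[of x] diag[of y] B(2)[of x y] G(2)[of x y]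
    by (simp add: bilinear_ladd[OF B(1)] bilinear_radd[OF B(1)] bilinear_ladd[OF G(1)]
        bilinear_radd[OF G(1)] algebra_simps)
  then show ?thesis by (rule that)
qed

subsection \<open>Spacelike surfaces in the hyperbolic space\<close>

text \<open>Bilinear forms in finite dimension are bounded; this makes the product rule and the
  smoothness rules available for the pseudo scalar product.\<close>

interpretation mink: bounded_bilinear "mink :: 'n::finite mspace \<Rightarrow> 'n mspace \<Rightarrow> real"
proof -
  have "bilinear (mink :: 'n mspace \<Rightarrow> 'n mspace \<Rightarrow> real)"
    unfolding bilinear_def
    by (auto intro!: linearI simp: mink_def algebra_simps inner_add_left inner_add_right)
  then show "bounded_bilinear (mink :: 'n mspace \<Rightarrow> 'n mspace \<Rightarrow> real)"
    by (simp add: bilinear_conv_bounded_bilinear)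
qed

lemma mink_commute: "mink x y = mink y x"
  by (simp add: mink_def inner_commute mult.commute)

locale spacelike_in_hyperbolic =
  fixes U :: "(real^'m::finite) set"
    and X :: "real^'m \<Rightarrow> 'n::finite mspace"
    and R :: real
  assumes dim: "CARD('n) \<ge> 3"
    and codim: "CARD('n) = CARD('m) + 1"
    and R: "R > 0"
    and M: "spacelike_surface U X"
    and sub: "X ` U \<subseteq> hyperbolic_plus 0 R"
begin

abbreviation "DX u \<equiv> frechet_derivative X (at u)"
text \<open>\<open>X\<close> is differentiated along \<open>y\<close> first and the result along
  \<open>x\<close>; on \<open>U\<close> the order is immaterial by
  \<open>D2X_commute\<close>.\<close>

abbreviation "D2X u x y \<equiv> frechet_derivative (\<lambda>v. DX v y) (at u) x"

lemma open_U: "open U" and connected_U: "connected U" and smooth_X: "smooth_on U X"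
  and inj_DX: "u \<in> U \<Longrightarrow> inj (DX u)"
  using M by (auto simp: spacelike_surface_def smooth_embedding_def)

lemma has_derivative_X: "u \<in> U \<Longrightarrow> (X has_derivative DX u) (at u)"
  by (rule smooth_on_has_derivative[OF smooth_X])

lemma linear_DX: "u \<in> U \<Longrightarrow> linear (DX u)"
  using has_derivative_linear[OF has_derivative_X] .

lemma DX_eq_0_iff: "u \<in> U \<Longrightarrow> DX u x = 0 \<longleftrightarrow> x = 0"
  using linear_injective_0[OF linear_DX] inj_DX linear_0[OF linear_DX] by blast

lemma mink_DX_pos: "u \<in> U \<Longrightarrow> x \<noteq> 0 \<Longrightarrow> mink (DX u x) (DX u x) > 0"
  using M DX_eq_0_iff by (auto simp: spacelike_surface_def tangent_space_def)

lemma mink_DX_eq_0_iff: "u \<in> U \<Longrightarrow> mink (DX u x) (DX u x) = 0 \<longleftrightarrow> x = 0"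
  by (metis mink_DX_pos DX_eq_0_iff less_irrefl mink.zero_left)

lemma mink_X_X: "u \<in> U \<Longrightarrow> mink (X u) (X u) = - R\<^sup>2"
  using sub by (auto simp: hyperbolic_plus_def)

text \<open>The squared height is at least \<open>R\<^sup>2\<close>, which excludes zero. The
  construction of the normal fields divides by this height.\<close>

lemma snd_X_pos:
  assumes "u \<in> U"
  shows "snd (X u) > 0"
proof -
  have "snd (X u) \<ge> 0" using sub assms by (auto simp: hyperbolic_plus_def)
  moreover have "(snd (X u))\<^sup>2 \<ge> R\<^sup>2"
    using mink_X_X[OF assms] by (simp add: mink_def power2_eq_square) (smt (verit) inner_ge_zero)
  then have "snd (X u) \<noteq> 0" using R by auto
  ultimately show ?thesis by simp
qed

lemma smooth_DX: "smooth_on U (\<lambda>u. DX u x)"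
  by (rule smooth_on_frechet_derivative[OF smooth_X])

lemma smooth_mink: "smooth_on U f \<Longrightarrow> smooth_on U g \<Longrightarrow> smooth_on U (\<lambda>u. mink (f u) (g u))"
  by (rule smooth_on_bilinear[OF open_U mink.bounded_bilinear_axioms])

lemma D2X_commute: "u \<in> U \<Longrightarrow> D2X u x y = D2X u y x"
  by (rule symmetric_second_derivative[OF open_U _ smooth_X])

section \<open>Differentiated orthogonality relations\<close>

lemma mink_derivative_const:
  assumes "smooth_on U f" "smooth_on U g" "\<And>u. u \<in> U \<Longrightarrow> mink (f u) (g u) = c" "u \<in> U"
  shows "mink (f u) (frechet_derivative g (at u) x) + mink (frechet_derivative f (at u) x) (g u) = 0"
proof -
  have D: "((\<lambda>u. mink (f u) (g u)) has_derivative (\<lambda>x. mink (f u) (frechet_derivative g (at u) x)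
     + mink (frechet_derivative f (at u) x) (g u))) (at u)"
    by (rule mink.FDERIV[OF smooth_on_has_derivative[OF assms(1,4)] smooth_on_has_derivative[OF assms(2,4)]])
  have "((\<lambda>u. c) has_derivative (\<lambda>x. mink (f u) (frechet_derivative g (at u) x)
     + mink (frechet_derivative f (at u) x) (g u))) (at u)"
    by (rule has_derivative_transform_within_open[OF D open_U assms(4)]) (simp add: assms(3))
  from fun_cong[OF has_derivative_unique[OF this has_derivative_const], of x] show ?thesis .
qed

lemma mink_X_DX: "u \<in> U \<Longrightarrow> mink (X u) (DX u y) = 0"
  using mink_derivative_const[OF smooth_X smooth_X mink_X_X, of u y] mink_commute[of "X u" "DX u y"]
  by simp

text \<open>The Weingarten equation: differentiating the orthogonality of \<open>N\<close> and
  \<open>DX u y\<close> trades the derivative of \<open>N\<close> for the second derivative of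
  \<open>X\<close>.\<close>

lemma mink_normal_derivative:
  assumes "smooth_on U N" "\<And>u y. u \<in> U \<Longrightarrow> mink (N u) (DX u y) = 0" "u \<in> U"
  shows "mink (frechet_derivative N (at u) x) (DX u y) = - mink (N u) (D2X u x y)"
  using mink_derivative_const[OF assms(1) smooth_DX assms(2,3), of y x] by simp

text \<open>The Weingarten equation for the position vector, a normal field whose derivative is
  \<open>DX\<close> itself.\<close>

lemma mink_X_D2X: "u \<in> U \<Longrightarrow> mink (X u) (D2X u x y) = - mink (DX u x) (DX u y)"
  using mink_normal_derivative[OF smooth_X mink_X_DX, of u x y] by simp

lemma mem_normal_plane: "z \<in> normal_plane X u \<longleftrightarrow> (\<forall>y. mink z (DX u y) = 0)"
  by (auto simp: normal_plane_def tangent_space_def)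

section \<open>Orthogonal frames of the normal plane\<close>

text \<open>A tangent \<open>f\<close>, or a \<open>g\<close> in the span of \<open>f\<close> and
  the tangent space, would be orthogonal to itself. Hence adjoining both raises the dimension by
  two, to that of the whole space.\<close>

lemma frame_expansion:
  assumes u: "u \<in> U"
    and f: "\<And>y. mink f (DX u y) = 0" "mink f f \<noteq> 0"
    and g: "\<And>y. mink g (DX u y) = 0" "mink g g \<noteq> 0"
    and fg: "mink f g = 0"
  obtains y a b where "z = DX u y + a *\<^sub>R f + b *\<^sub>R g"
proof -
  let ?T = "range (DX u)"
  have spT: "span ?T = ?T"
    using linear_subspace_image[OF linear_DX[OF u] subspace_UNIV] by (simp add: span_eq_iff)
  have dimT: "dim ?T = CARD('m)"
    using dim_image_eq[OF linear_DX[OF u], of UNIV] inj_DX[OF u] by simp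
  have fT: "f \<notin> span ?T" unfolding spT using f by auto
  have gT: "g \<notin> span (insert f ?T)"
  proof
    assume "g \<in> span (insert f ?T)"
    then obtain k y where "g - k *\<^sub>R f = DX u y" by (auto simp: span_breakdown_eq spT)
    then have "g = k *\<^sub>R f + DX u y" by (simp add: algebra_simps)
    then have "mink g g = mink g (k *\<^sub>R f + DX u y)" by simp
    then show False using g fg by (simp add: mink.add_right mink.scaleR_right mink_commute[of g f])
  qed
  have "dim (insert g (insert f ?T)) = DIM('n mspace)"
    using fT gT dimT codim by (simp add: dim_insert)
  then have "z \<in> span (insert g (insert f ?T))" unfolding dim_eq_full by simp
  then obtain b where "z - b *\<^sub>R g \<in> span (insert f ?T)"
    unfolding span_breakdown_eq[of z] by blast
  then obtain a where "z - b *\<^sub>R g - a *\<^sub>R f \<in> ?T"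
    unfolding span_breakdown_eq[of "z - b *\<^sub>R g"] spT by blast
  then obtain y where "z - b *\<^sub>R g - a *\<^sub>R f = DX u y" by blast
  then have "z = DX u y + a *\<^sub>R f + b *\<^sub>R g" by (simp add: algebra_simps)
  then show ?thesis by (rule that)
qed

text \<open>Pairing with the tangential component itself kills that component by positivity; pairing
  with \<open>f\<close> and \<open>g\<close> reads off the two coefficients.\<close>

lemma normal_expansion:
  assumes u: "u \<in> U"
    and f: "\<And>y. mink f (DX u y) = 0" "mink f f \<noteq> 0"
    and g: "\<And>y. mink g (DX u y) = 0" "mink g g \<noteq> 0"
    and fg: "mink f g = 0"
    and z: "\<And>y. mink z (DX u y) = 0"
  shows "z = (mink z f / mink f f) *\<^sub>R f + (mink z g / mink g g) *\<^sub>R g"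
proof -
  obtain y a b where zeq: "z = DX u y + a *\<^sub>R f + b *\<^sub>R g"
    using frame_expansion[OF u f g fg] by blast
  have "mink z (DX u y) = mink (DX u y) (DX u y)"
    by (simp add: zeq mink.add_left mink.scaleR_left f g)
  then have "y = 0" using z mink_DX_eq_0_iff[OF u] by simp
  then have z2: "z = a *\<^sub>R f + b *\<^sub>R g" using zeq linear_0[OF linear_DX[OF u]] by simp
  have "mink z f = a * mink f f" "mink z g = b * mink g g"
    using fg by (simp_all add: z2 mink.add_left mink.scaleR_left mink_commute[of g f])
  then show ?thesis using f g z2 by simp
qed

section \<open>Globally smooth normal fields\<close>

text \<open>The cross product of the spatial parts of the coordinate tangent vectors, normalised and
  given height zero. At height zero, \<open>mink\<close> reduces to the Euclidean product of the
  spatial parts.\<close>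

lemma exists_smooth_spatial_normal:
  obtains s where "smooth_on U s" "\<And>u. u \<in> U \<Longrightarrow> snd (s u) = 0"
    "\<And>u. u \<in> U \<Longrightarrow> mink (s u) (s u) = 1" "\<And>u y. u \<in> U \<Longrightarrow> mink (s u) (DX u y) = 0"
proof -
  \<comment> \<open>An arbitrary row is reserved for the free argument of the cross product;
    \<open>g\<close> matches the remaining rows with the parameter directions.\<close>
  obtain k :: 'n where True by simp
  have "card (UNIV - {k}) = CARD('m)" using codim by (simp add: card_Diff_singleton)
  then obtain g where g: "bij_betw g (UNIV - {k}) (UNIV :: 'm set)"
    by (metis bij_betw_iff_card finite)
  define V where "V u i = fst (DX u (axis (g i) 1))" for u i
  define S0 where "S0 u = cross_rows k (V u)" for u
  have "smooth_on U (\<lambda>u. V u i)" for i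
    unfolding V_def by (rule smooth_on_linear[OF open_U bounded_linear_fst smooth_DX])
  then have sm: "smooth_on U S0"
    unfolding S0_def by (rule smooth_on_cross_rows[OF open_U])
  have nz: "S0 u \<noteq> 0" if u: "u \<in> U" for u
    unfolding S0_def
  proof (rule cross_rows_nonzero)
    fix c :: "'n \<Rightarrow> real"
    assume *: "(\<Sum>i\<in>UNIV - {k}. c i *\<^sub>R V u i) = 0"
    define x :: "real^'m" where "x = (\<Sum>i\<in>UNIV - {k}. c i *\<^sub>R axis (g i) 1)"
    have "fst (DX u x) = (\<Sum>i\<in>UNIV - {k}. c i *\<^sub>R V u i)"
      by (simp add: x_def V_def linear_sum[OF linear_DX[OF u]] linear_scale[OF linear_DX[OF u]] fst_sum)
    \<comment> \<open>A dependence among spatial parts would give a tangent vector with vanishing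
      spatial part, which cannot be spacelike and so is zero.\<close>
    then have "mink (DX u x) (DX u x) \<le> 0" using * by (simp add: mink_def)
    then have x0: "x = 0" using mink_DX_pos[OF u, of x] by force
    show "\<forall>i. i \<noteq> k \<longrightarrow> c i = 0"
    proof (intro allI impI)
      fix j assume j: "j \<noteq> k"
      have "x $ g j = (\<Sum>i\<in>UNIV - {k}. c i * (if i = j then 1 else 0))"
        unfolding x_def sum_component using j bij_betw_imp_inj_on[OF g]
        by (intro sum.cong) (auto simp: axis_def inj_on_def)
      also have "\<dots> = c j" using j by (simp add: sum.remove[of _ j])
      finally show "c j = 0" using x0 by simp
    qed
  qed
  have orth: "S0 u \<bullet> fst (DX u y) = 0" if u: "u \<in> U" for u y
  proof -
    have "S0 u \<bullet> fst (DX u (axis j 1)) = 0" for j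
    proof -
      obtain i where "i \<noteq> k" "g i = j" using g by (metis Diff_iff UNIV_I bij_betw_iff_bijections singletonI)
      then show ?thesis using cross_rows_orthogonal[of i k "V u"] by (simp add: S0_def V_def)
    qed
    moreover have "y = (\<Sum>j\<in>UNIV. y $ j *\<^sub>R axis j 1)"
      using basis_expansion[of y] unfolding scalar_mult_eq_scaleR by simp
    then have "fst (DX u y) = (\<Sum>j\<in>UNIV. y $ j *\<^sub>R fst (DX u (axis j 1)))"
      by (metis (mono_tags, lifting) linear_sum[OF linear_DX[OF u]] linear_scale[OF linear_DX[OF u]]
          fst_sum fst_scaleR sum.cong)
    ultimately show ?thesis by (simp add: inner_sum_right)
  qed
  let ?c = "\<lambda>u. inverse (sqrt (S0 u \<bullet> S0 u))"
  show ?thesis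
  proof (rule that[of "\<lambda>u. (?c u *\<^sub>R S0 u, 0)"])
    have "smooth_on U (\<lambda>u. ?c u *\<^sub>R S0 u)"
      using nz by (intro smooth_on_scaleR smooth_on_inverse smooth_on_sqrt smooth_on_inner sm open_U) auto
    then show "smooth_on U (\<lambda>u. (?c u *\<^sub>R S0 u, 0::real))"
      by (rule smooth_on_linear[OF open_U, of "\<lambda>v. (v, 0)", rotated])
         (intro bounded_linear_Pair bounded_linear_ident bounded_linear_zero)
    show "mink (?c u *\<^sub>R S0 u, 0) (?c u *\<^sub>R S0 u, 0) = 1" if "u \<in> U" for u
      using nz[OF that] by (simp add: mink_def dot_square_norm power2_eq_square)
    show "mink (?c u *\<^sub>R S0 u, 0) (DX u y) = 0" if "u \<in> U" for u y
      using orth[OF that] by (simp add: mink_def)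
  qed simp
qed

definition smooth_normal_field :: "(real^'m \<Rightarrow> 'n mspace) \<Rightarrow> bool"
  where "smooth_normal_field N \<longleftrightarrow> smooth_on U N \<and> (\<forall>u\<in>U. \<forall>y. mink (N u) (DX u y) = 0)"

text \<open>The unit normal of the surface inside the hyperbolic space (the de Sitter Gauss map).\<close>

definition de_sitter_normal :: "(real^'m \<Rightarrow> 'n mspace) \<Rightarrow> bool"
  where "de_sitter_normal E \<longleftrightarrow>
    smooth_normal_field E \<and> (\<forall>u\<in>U. mink (E u) (X u) = 0 \<and> mink (E u) (E u) = 1)"

lemma smooth_normal_fieldD:
  assumes "smooth_normal_field N"
  shows "smooth_on U N" "u \<in> U \<Longrightarrow> mink (N u) (DX u y) = 0"
    "u \<in> U \<Longrightarrow> mink (frechet_derivative N (at u) x) (DX u y) = - mink (N u) (D2X u x y)"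
  using assms mink_normal_derivative[of N u x y] by (auto simp: smooth_normal_field_def)

lemma de_sitter_normalD:
  assumes "de_sitter_normal E"
  shows "smooth_normal_field E" "u \<in> U \<Longrightarrow> mink (E u) (X u) = 0" "u \<in> U \<Longrightarrow> mink (E u) (E u) = 1"
    "smooth_on U E" "u \<in> U \<Longrightarrow> mink (E u) (DX u y) = 0"
  using assms by (auto simp: de_sitter_normal_def smooth_normal_field_def)

text \<open>Since \<open>X u\<close> has square \<open>- R\<^sup>2\<close>, adding
  \<open>(\<sigma> u / R\<^sup>2) *\<^sub>R X u\<close> to \<open>s u\<close> removes its component
  along \<open>X u\<close>. The result has square \<open>q u > 0\<close>, so it can be normalised
  smoothly on all of \<open>U\<close>.\<close>

lemma exists_de_sitter_normal: obtains E where "de_sitter_normal E"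
proof -
  obtain s where sms: "smooth_on U s" and "\<And>u. u \<in> U \<Longrightarrow> snd (s u) = 0"
    and mss: "\<And>u. u \<in> U \<Longrightarrow> mink (s u) (s u) = 1" and Ns: "\<And>u y. u \<in> U \<Longrightarrow> mink (s u) (DX u y) = 0"
    by (rule exists_smooth_spatial_normal) (rule that)
  define \<sigma> where "\<sigma> u = mink (X u) (s u)" for u
  define q where "q u = 1 + (\<sigma> u)\<^sup>2 / R\<^sup>2" for u
  define E where "E u = inverse (sqrt (q u)) *\<^sub>R (s u + (\<sigma> u / R\<^sup>2) *\<^sub>R X u)" for u
  have sm\<sigma>: "smooth_on U \<sigma>" unfolding \<sigma>_def by (rule smooth_mink[OF smooth_X sms])
  have q: "q u > 0" for u unfolding q_def by (simp add: add_pos_nonneg)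
  show ?thesis
  proof (rule that[of E], unfold de_sitter_normal_def smooth_normal_field_def, intro conjI ballI allI)
    have "smooth_on U q" unfolding q_def power2_eq_square
      using R by (intro smooth_on_add smooth_on_divide smooth_on_mult smooth_on_const sm\<sigma> open_U) auto
    then show "smooth_on U E"
      unfolding E_def using R q
      by (intro smooth_on_scaleR smooth_on_inverse smooth_on_sqrt smooth_on_add sms smooth_on_divide
          sm\<sigma> smooth_X smooth_on_const open_U) (auto simp: less_imp_neq[symmetric])
    show "mink (E u) (DX u y) = 0" if "u \<in> U" for u y
      by (simp add: E_def mink.add_left mink.scaleR_left mink_X_DX[OF that] Ns[OF that])
    have sX: "mink (s u) (X u) = \<sigma> u" for u by (simp add: \<sigma>_def mink_commute)
    show "mink (E u) (X u) = 0" if "u \<in> U" for u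
      using R by (simp add: E_def mink.add_left mink.scaleR_left mink_X_X[OF that] sX)
    show "mink (E u) (E u) = 1" if "u \<in> U" for u
    proof -
      let ?k = "\<sigma> u / R\<^sup>2"
      have "mink (s u + ?k *\<^sub>R X u) (s u + ?k *\<^sub>R X u) = 1 + 2 * ?k * \<sigma> u - ?k\<^sup>2 * R\<^sup>2"
        unfolding mink.add_left mink.add_right mink.scaleR_left mink.scaleR_right mss[OF that] sX
          mink_X_X[OF that] \<sigma>_def[symmetric] by (simp add: power2_eq_square)
      then have "mink (E u) (E u) = (inverse (sqrt (q u)))\<^sup>2 * (1 + 2 * ?k * \<sigma> u - ?k\<^sup>2 * R\<^sup>2)"
        by (simp add: E_def mink.scaleR_left mink.scaleR_right power2_eq_square)
      also have "1 + 2 * (\<sigma> u / R\<^sup>2) * \<sigma> u - (\<sigma> u / R\<^sup>2)\<^sup>2 * R\<^sup>2 = q u"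
        using R by (simp add: q_def power2_eq_square field_simps)
      also have "(inverse (sqrt (q u)))\<^sup>2 * q u = 1"
        using q[of u] by (simp add: power_inverse)
      finally show ?thesis .
    qed
  qed
qed

section \<open>Normal vectors of prescribed height\<close>

text \<open>Shifting the centre to \<open>(0, -1)\<close> turns the hyperboloid equation at height
  \<open>r\<close> into a square of \<open>2 * r\<close>; the condition \<open>r + 1 \<ge> 0\<close>
  is automatic. In particular these vectors are spacelike.\<close>

lemma normal_section_iff:
  assumes "r > 0"
  shows "z \<in> normal_section X r u \<longleftrightarrow> (\<forall>y. mink z (DX u y) = 0) \<and> snd z = r \<and> mink z z = 2 * r"
proof -
  have "mink (z - (0, -1)) (z - (0, -1)) = mink z z - 2 * snd z - 1"
    by (simp add: mink_def algebra_simps)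
  then show ?thesis
    using assms by (auto simp: normal_section_def mem_normal_plane hyperbolic_plus_def)
qed

text \<open>In the orthogonal frame \<open>\<tau>\<close>, \<open>s\<close> only
  \<open>\<tau>\<close> has height, so the height fixes its coefficient. The square then fixes the
  coefficient of \<open>s\<close> up to sign, and both roots are smooth and distinct because
  \<open>\<beta> > 0\<close>.\<close>

lemma exists_normal_field:
  assumes r: "r > 0"
  obtains n where "\<And>s. smooth_on U (n s)"
    "\<And>u. u \<in> U \<Longrightarrow> n Plus u \<noteq> n Minus u"
    "\<And>u. u \<in> U \<Longrightarrow> normal_section X r u = {n Plus u, n Minus u}"
proof -
  obtain s where sms: "smooth_on U s" and sn: "\<And>u. u \<in> U \<Longrightarrow> snd (s u) = 0"
    and mss: "\<And>u. u \<in> U \<Longrightarrow> mink (s u) (s u) = 1" and Ns: "\<And>u y. u \<in> U \<Longrightarrow> mink (s u) (DX u y) = 0"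
    by (rule exists_smooth_spatial_normal) (rule that)
  define \<sigma> where "\<sigma> u = mink (X u) (s u)" for u
  \<comment> \<open>The Gram-Schmidt step applied to \<open>X u\<close>: orthogonal to
    \<open>s u\<close>, still of the height of \<open>X u\<close>, and timelike.\<close>
  define \<tau> where "\<tau> u = X u - \<sigma> u *\<^sub>R s u" for u
  define \<beta> where "\<beta> u = sqrt (2 * r + (r / snd (X u))\<^sup>2 * (R\<^sup>2 + (\<sigma> u)\<^sup>2))" for u
  define n where "n g u = (case g of Plus \<Rightarrow> (r / snd (X u)) *\<^sub>R \<tau> u + \<beta> u *\<^sub>R s u
    | Minus \<Rightarrow> (r / snd (X u)) *\<^sub>R \<tau> u - \<beta> u *\<^sub>R s u)" for g u
  have sm\<sigma>: "smooth_on U \<sigma>" unfolding \<sigma>_def by (rule smooth_mink[OF smooth_X sms])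
  have sm\<tau>: "smooth_on U \<tau>" unfolding \<tau>_def
    by (intro smooth_on_diff smooth_on_scaleR smooth_X sm\<sigma> sms open_U)
  have sma: "smooth_on U (\<lambda>u. r / snd (X u))"
    using snd_X_pos
    by (intro smooth_on_divide smooth_on_const smooth_on_linear[OF _ bounded_linear_snd] smooth_X open_U) force
  have rad: "2 * r + (r / snd (X u))\<^sup>2 * (R\<^sup>2 + (\<sigma> u)\<^sup>2) > 0" for u
    using r by (intro add_pos_nonneg) auto
  then have \<beta>: "\<beta> u > 0" "(\<beta> u)\<^sup>2 = 2 * r + (r / snd (X u))\<^sup>2 * (R\<^sup>2 + (\<sigma> u)\<^sup>2)" for u
    by (simp_all add: \<beta>_def less_imp_le)
  have sm\<beta>: "smooth_on U \<beta>"
    unfolding \<beta>_def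
    by (rule smooth_on_sqrt[OF open_U _ rad], unfold power2_eq_square)
       (intro smooth_on_add smooth_on_mult smooth_on_const sma sm\<sigma> open_U)
  have ms\<tau>: "mink (\<tau> u) (s u) = 0" if "u \<in> U" for u
    by (simp add: \<tau>_def mink.diff_left mink.scaleR_left mss[OF that] \<sigma>_def)
  have m\<tau>\<tau>: "mink (\<tau> u) (\<tau> u) = - (R\<^sup>2 + (\<sigma> u)\<^sup>2)" if "u \<in> U" for u
  proof -
    have "mink (\<tau> u) (\<tau> u) = mink (\<tau> u) (X u)"
      using ms\<tau>[OF that] by (subst (2) \<tau>_def) (simp add: mink.diff_right mink.scaleR_right)
    also have "\<dots> = - (R\<^sup>2 + (\<sigma> u)\<^sup>2)"
      by (simp add: \<tau>_def mink.diff_left mink.scaleR_left mink_X_X[OF that] mink_commute[of "s u" "X u"]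
          \<sigma>_def power2_eq_square)
    finally show ?thesis .
  qed
  have N\<tau>: "mink (\<tau> u) (DX u y) = 0" if "u \<in> U" for u y
    using that by (simp add: \<tau>_def mink.diff_left mink.scaleR_left mink_X_DX Ns)
  have "R\<^sup>2 > 0" using R by simp
  then have "R\<^sup>2 + (\<sigma> u)\<^sup>2 > 0" for u by (simp add: add_pos_nonneg)
  then have nz: "mink (\<tau> u) (\<tau> u) \<noteq> 0" "mink (s u) (s u) \<noteq> 0" if "u \<in> U" for u
    unfolding m\<tau>\<tau>[OF that] mss[OF that] by (metis less_irrefl neg_0_equal_iff_equal, simp)
  have snd: "snd (\<tau> u) = snd (X u)" if "u \<in> U" for u using sn[OF that] by (simp add: \<tau>_def)
  show ?thesis
  proof (rule that[of n])
    show "smooth_on U (n g)" for g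
      unfolding n_def
      by (cases g) (auto intro!: smooth_on_add smooth_on_diff smooth_on_scaleR sma sm\<tau> sm\<beta> sms open_U)
    show "n Plus u \<noteq> n Minus u" if u: "u \<in> U" for u
    proof
      assume "n Plus u = n Minus u"
      then have "(2 * \<beta> u) *\<^sub>R s u = 0" by (simp add: n_def algebra_simps flip: scaleR_add_left)
      then have "s u = 0" using \<beta>(1)[of u] by simp
      then show False using nz(2)[OF u] by (simp add: mink.zero_left)
    qed
    show "normal_section X r u = {n Plus u, n Minus u}" if u: "u \<in> U" for u
    proof (rule set_eqI)
      fix z
      have comb: "mink (a *\<^sub>R \<tau> u + b *\<^sub>R s u) (a *\<^sub>R \<tau> u + b *\<^sub>R s u) = b\<^sup>2 - a\<^sup>2 * (R\<^sup>2 + (\<sigma> u)\<^sup>2)" for a b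
        by (simp add: mink.add_left mink.add_right mink.scaleR_left mink.scaleR_right m\<tau>\<tau>[OF u]
            mss[OF u] ms\<tau>[OF u] mink_commute[of "s u" "\<tau> u"] power2_eq_square algebra_simps)
      have mem: "a *\<^sub>R \<tau> u + b *\<^sub>R s u \<in> normal_section X r u \<longleftrightarrow> a = r / snd (X u) \<and> (b = \<beta> u \<or> b = - \<beta> u)" for a b
      proof -
        have "a * snd (X u) = r \<longleftrightarrow> a = r / snd (X u)" using snd_X_pos[OF u] by (auto simp: field_simps)
        moreover have "b\<^sup>2 - (r / snd (X u))\<^sup>2 * (R\<^sup>2 + (\<sigma> u)\<^sup>2) = 2 * r \<longleftrightarrow> b = \<beta> u \<or> b = - \<beta> u"
          using \<beta>(2)[of u] by (auto simp: power2_eq_iff[symmetric])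
        ultimately show ?thesis
          unfolding normal_section_iff[OF r] comb
          by (auto simp: mink.add_left mink.scaleR_left Ns[OF u] N\<tau>[OF u] snd[OF u] sn[OF u])
      qed
      have minus: "n Minus u = (r / snd (X u)) *\<^sub>R \<tau> u + (- \<beta> u) *\<^sub>R s u" by (simp add: n_def)
      have plus: "n Plus u = (r / snd (X u)) *\<^sub>R \<tau> u + \<beta> u *\<^sub>R s u" by (simp add: n_def)
      show "z \<in> normal_section X r u \<longleftrightarrow> z \<in> {n Plus u, n Minus u}"
      proof
        assume z: "z \<in> normal_section X r u"
        then have "\<And>y. mink z (DX u y) = 0" by (simp add: normal_section_iff[OF r])
        from normal_expansion[OF u N\<tau>[OF u] nz(1)[OF u] Ns[OF u] nz(2)[OF u] ms\<tau>[OF u] this]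
        obtain a b where zab: "z = a *\<^sub>R \<tau> u + b *\<^sub>R s u" by blast
        show "z \<in> {n Plus u, n Minus u}"
          using z unfolding zab mem plus minus by auto
      next
        assume "z \<in> {n Plus u, n Minus u}"
        then show "z \<in> normal_section X r u" by (auto simp only: plus minus mem)
      qed
    qed
  qed
qed

text \<open>The existence result shows that the choice in \<open>normal_field\<close> succeeds, so
  its defining properties may be used; these consequences hold under either labelling of the two
  fields.\<close>

lemma normal_field:
  assumes r: "r > 0"
  shows "smooth_normal_field (normal_field U X r s)"
    and "u \<in> U \<Longrightarrow> mink (normal_field U X r s u) (normal_field U X r s u) = 2 * r"
proof -
  let ?P = "\<lambda>n. (\<forall>s. smooth_on U (n s)) \<and>
    (\<forall>u\<in>U. n Plus u \<noteq> n Minus u \<and> normal_section X r u = {n Plus u, n Minus u})"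
  have "\<exists>n. ?P n" using exists_normal_field[OF r] by metis
  then have P: "?P (normal_field U X r)"
    unfolding normal_field_def by (rule someI_ex)
  have "normal_field U X r s u \<in> normal_section X r u" if "u \<in> U" for u
    using P that by (cases s) auto
  note sec = this[unfolded normal_section_iff[OF r]]
  show "smooth_normal_field (normal_field U X r s)"
    using P sec unfolding smooth_normal_field_def by blast
  show "u \<in> U \<Longrightarrow> mink (normal_field U X r s u) (normal_field U X r s u) = 2 * r"
    using sec by blast
qed

section \<open>The Weingarten map as a bilinear form\<close>

text \<open>The definite description is well defined: the frame \<open>X\<close>, \<open>E\<close>
  yields a decomposition, and positivity on tangent vectors makes it unique.\<close>

lemma tangential_part:
  assumes u: "u \<in> U"
  obtains y where "tangential_part X u z = DX u y" "\<And>x. mink (DX u y) (DX u x) = mink z (DX u x)"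
proof -
  obtain E where "de_sitter_normal E" using exists_de_sitter_normal by blast
  note E = de_sitter_normalD[OF this]
  have "mink (X u) (X u) \<noteq> 0" "mink (E u) (E u) \<noteq> 0" "mink (X u) (E u) = 0"
    using R E(2,3)[OF u] by (simp_all add: mink_X_X[OF u] mink_commute[of "X u" "E u"])
  then obtain y a b where z: "z = DX u y + a *\<^sub>R X u + b *\<^sub>R E u"
    using frame_expansion[OF u mink_X_DX[OF u] _ E(5)[OF u]] by blast
  have zy: "mink (z - DX u y) (DX u x) = 0" for x
    by (simp add: z mink.add_left mink.scaleR_left mink_X_DX[OF u] E(5)[OF u])
  have "tangential_part X u z = DX u y"
    unfolding tangential_part_def
  proof (rule the_equality)
    show "DX u y \<in> tangent_space X u \<and> z - DX u y \<in> normal_plane X u"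
      using zy by (auto simp: tangent_space_def mem_normal_plane)
    fix t assume "t \<in> tangent_space X u \<and> z - t \<in> normal_plane X u"
    then obtain y' where t: "t = DX u y'" "\<And>x. mink (z - t) (DX u x) = 0"
      by (auto simp: tangent_space_def mem_normal_plane)
    have "mink (DX u (y' - y)) (DX u x) = 0" for x
      using t(2)[of x] zy[of x] by (simp add: t(1) linear_diff[OF linear_DX[OF u]] mink.diff_left)
    then have "y' = y" using mink_DX_eq_0_iff[OF u, of "y' - y"] by simp
    then show "t = DX u y" by (simp add: t)
  qed
  moreover have "mink (DX u y) (DX u x) = mink z (DX u x)" for x
    using zy[of x] by (simp add: mink.diff_left)
  ultimately show ?thesis by (rule that)
qed

text \<open>The metric is definite, so a tangent vector is determined by its products with tangent
  vectors. The minus sign in \<open>weingarten\<close> cancels the one in the Weingarten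
  equation.\<close>

lemma eigenvalue_weingarten_iff:
  assumes u: "u \<in> U" and N: "smooth_normal_field N"
  shows "eigenvalue_on (tangent_space X u) (weingarten X N u) l \<longleftrightarrow>
    (\<exists>x. x \<noteq> 0 \<and> (\<forall>y. mink (N u) (D2X u x y) = l * mink (DX u x) (DX u y)))"
proof -
  have "weingarten X N u (DX u x) = l *\<^sub>R DX u x \<longleftrightarrow>
      (\<forall>y. mink (N u) (D2X u x y) = l * mink (DX u x) (DX u y))" for x
  proof -
    obtain t where t: "tangential_part X u (frechet_derivative N (at u) x) = DX u t"
      "\<And>y. mink (DX u t) (DX u y) = mink (frechet_derivative N (at u) x) (DX u y)"
      using tangential_part[OF u] by blast
    have W: "weingarten X N u (DX u x) = DX u (- t)"
      by (simp add: weingarten_def inv_f_f[OF inj_DX[OF u]] t(1) linear_neg[OF linear_DX[OF u]])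
    have "DX u (- t) = l *\<^sub>R DX u x \<longleftrightarrow> - t - l *\<^sub>R x = 0"
      using DX_eq_0_iff[OF u, of "- t - l *\<^sub>R x"]
      by (simp add: linear_diff[OF linear_DX[OF u]] linear_scale[OF linear_DX[OF u]])
    also have "\<dots> \<longleftrightarrow> (\<forall>y. mink (DX u (- t - l *\<^sub>R x)) (DX u y) = 0)"
      by (metis mink_DX_eq_0_iff[OF u] linear_0[OF linear_DX[OF u]] mink.zero_left)
    also have "\<dots> \<longleftrightarrow> (\<forall>y. mink (N u) (D2X u x y) = l * mink (DX u x) (DX u y))"
      by (simp add: linear_diff[OF linear_DX[OF u]] linear_scale[OF linear_DX[OF u]]
          linear_neg[OF linear_DX[OF u]] mink.diff_left mink.minus_left mink.scaleR_left t(2)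
          smooth_normal_fieldD(3)[OF N u])
    finally show ?thesis by (simp add: W)
  qed
  then show ?thesis
    by (auto simp: eigenvalue_on_def tangent_space_def DX_eq_0_iff[OF u])
qed

text \<open>Linearity in \<open>x\<close> is that of a derivative; linearity in \<open>y\<close>
  follows from symmetry.\<close>

lemma bilinear_mink_D2X: "u \<in> U \<Longrightarrow> bilinear (\<lambda>x y. mink z (D2X u x y))"
  unfolding bilinear_def
proof (intro conjI allI)
  assume u: "u \<in> U"
  have lin: "linear (\<lambda>x. D2X u x y)" for y
    using has_derivative_linear[OF smooth_on_has_derivative[OF smooth_DX u]] .
  have linz: "linear (mink z)"
    by (rule bounded_linear.linear[OF mink.bounded_linear_right])
  show l: "linear (\<lambda>x. mink z (D2X u x y))" for y
    using linear_compose[OF lin linz] by (simp add: o_def)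
  show "linear (\<lambda>y. mink z (D2X u x y))" for x
    using l[of x] by (simp add: D2X_commute[OF u, of x])
qed

lemma bilinear_mink_DX: "u \<in> U \<Longrightarrow> bilinear (\<lambda>x y. mink (DX u x) (DX u y))"
  unfolding bilinear_def
  by (auto intro!: linearI simp: linear_add[OF linear_DX] linear_scale[OF linear_DX]
      mink.add_left mink.add_right mink.scaleR_left mink.scaleR_right)

text \<open>The form \<open>mink (N u) (D2X u x y)\<close> is symmetric, so it has relative
  eigenvectors, and a single eigenvalue makes it a multiple of the induced metric.\<close>

lemma umbilic_iff:
  assumes N: "smooth_normal_field N"
  shows "umbilic U X N \<longleftrightarrow>
    (\<forall>u\<in>U. \<exists>k. \<forall>x y. mink (N u) (D2X u x y) = k * mink (DX u x) (DX u y))"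
    (is "_ \<longleftrightarrow> (\<forall>u\<in>U. ?Q u)")
proof -
  have "(\<forall>l l'. eigenvalue_on (tangent_space X u) (weingarten X N u) l \<and>
      eigenvalue_on (tangent_space X u) (weingarten X N u) l' \<longrightarrow> l = l') \<longleftrightarrow> ?Q u"
    (is "?L \<longleftrightarrow> _") if u: "u \<in> U" for u
  proof
    assume ?L
    then have single: "l = l'"
      if "x \<noteq> 0" "x' \<noteq> 0" "\<And>y. mink (N u) (D2X u x y) = l * mink (DX u x) (DX u y)"
        "\<And>y. mink (N u) (D2X u x' y) = l' * mink (DX u x') (DX u y)" for l l' x x'
      using that unfolding eigenvalue_weingarten_iff[OF u N] by blast
    obtain k where "\<And>x y. mink (N u) (D2X u x y) = k * mink (DX u x) (DX u y)"
    proof (rule symmetric_bilinear_single_eigenvalue[OF bilinear_mink_D2X[OF u] _ bilinear_mink_DX[OF u]])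
      show "mink (N u) (D2X u x y) = mink (N u) (D2X u y x)" for x y
        by (simp add: D2X_commute[OF u, of x])
      show "mink (DX u x) (DX u y) = mink (DX u y) (DX u x)" for x y
        by (rule mink_commute)
    qed (use single mink_DX_pos[OF u] in blast)+
    then show "?Q u" by blast
  next
    assume "?Q u"
    then obtain k where k: "\<And>x y. mink (N u) (D2X u x y) = k * mink (DX u x) (DX u y)" by blast
    have "l = k" if "eigenvalue_on (tangent_space X u) (weingarten X N u) l" for l
      using that unfolding eigenvalue_weingarten_iff[OF u N] k
      by (metis mink_DX_eq_0_iff[OF u] mult_right_cancel)
    then show ?L by blast
  qed
  then show ?thesis unfolding umbilic_def by blast
qed

subsection \<open>Umbilicity and hyperplanes\<close>

text \<open>With the field written as \<open>a *\<^sub>R X u + b *\<^sub>R E u\<close>, its form is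
  \<open>b\<close> times that of \<open>E\<close> minus \<open>a\<close> times the metric. For
  \<open>b \<noteq> 0\<close> proportionality to the metric passes both ways.\<close>

lemma umbilic_normal_field_iff:
  assumes dS: "de_sitter_normal E"
    and r: "r > 0"
  shows "umbilic U X (normal_field U X r s) \<longleftrightarrow> umbilic U X E"
proof -
  note E = de_sitter_normalD[OF dS] and N = normal_field[OF r, where s = s]
  have "(\<exists>k. \<forall>x y. mink (normal_field U X r s u) (D2X u x y) = k * mink (DX u x) (DX u y)) \<longleftrightarrow>
      (\<exists>k. \<forall>x y. mink (E u) (D2X u x y) = k * mink (DX u x) (DX u y))" if u: "u \<in> U" for u
  proof -
    have XE: "mink (X u) (X u) \<noteq> 0" "mink (E u) (E u) \<noteq> 0" "mink (X u) (E u) = 0"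
      using R E(2,3)[OF u] by (simp_all add: mink_X_X[OF u] mink_commute[of "X u" "E u"])
    obtain a b where n: "normal_field U X r s u = a *\<^sub>R X u + b *\<^sub>R E u"
      using normal_expansion[OF u mink_X_DX[OF u] XE(1) E(5)[OF u] XE(2,3) smooth_normal_fieldD(2)[OF N(1) u]] by blast
    \<comment> \<open>The field is spacelike while \<open>X u\<close> is timelike, so the
      coefficient of \<open>E u\<close> cannot vanish.\<close>
    have "2 * r = b\<^sup>2 - a\<^sup>2 * R\<^sup>2"
      using N(2)[OF u]
      by (simp add: n mink.add_left mink.add_right mink.scaleR_left mink.scaleR_right
          mink_X_X[OF u] E(2,3)[OF u] XE(3) power2_eq_square)
    then have "b \<noteq> 0"
      using r by (smt (verit) mult_nonneg_nonneg power_zero_numeral zero_le_power2)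
    have eq: "mink (normal_field U X r s u) (D2X u x y)
        = b * mink (E u) (D2X u x y) - a * mink (DX u x) (DX u y)" for x y
      by (simp add: n mink.add_left mink.scaleR_left mink_X_D2X[OF u])
    show ?thesis
    proof
      assume "\<exists>k. \<forall>x y. mink (normal_field U X r s u) (D2X u x y) = k * mink (DX u x) (DX u y)"
      then obtain k where "\<And>x y. b * mink (E u) (D2X u x y) = (k + a) * mink (DX u x) (DX u y)"
        unfolding eq by (auto simp: algebra_simps)
      then have "mink (E u) (D2X u x y) = ((k + a) / b) * mink (DX u x) (DX u y)" for x y
        using \<open>b \<noteq> 0\<close> by (simp add: field_simps)
      then show "\<exists>k. \<forall>x y. mink (E u) (D2X u x y) = k * mink (DX u x) (DX u y)" by blast
    next
      assume "\<exists>k. \<forall>x y. mink (E u) (D2X u x y) = k * mink (DX u x) (DX u y)"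
      then obtain k where "\<And>x y. mink (E u) (D2X u x y) = k * mink (DX u x) (DX u y)" by blast
      then have "mink (normal_field U X r s u) (D2X u x y) = (b * k - a) * mink (DX u x) (DX u y)" for x y
        unfolding eq by (simp add: algebra_simps)
      then show "\<exists>k. \<forall>x y. mink (normal_field U X r s u) (D2X u x y) = k * mink (DX u x) (DX u y)" by blast
    qed
  qed
  then show ?thesis
    unfolding umbilic_iff[OF N(1)] umbilic_iff[OF E(1)] by blast
qed

lemma umbilic_imp_hyperplane:
  assumes dS: "de_sitter_normal E"
    and umb: "umbilic U X E"
  shows "\<exists>N c. N \<noteq> 0 \<and> X ` U \<subseteq> hyperplane N c"
proof -
  note E = de_sitter_normalD[OF dS]
  let ?DE = "\<lambda>u. frechet_derivative E (at u)"
  obtain v :: "real^'m" where v: "v \<noteq> 0" by (metis axis_eq_0_iff zero_neq_one)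
  \<comment> \<open>Evaluating the proportionality factor on one fixed direction \<open>v\<close>
    exhibits it as a smooth function of \<open>u\<close>.\<close>
  define k where "k u = mink (E u) (D2X u v v) / mink (DX u v) (DX u v)" for u
  have smk: "smooth_on U k"
    unfolding k_def using mink_DX_pos[OF _ v]
    by (intro smooth_on_divide smooth_mink E(4) smooth_DX smooth_on_frechet_derivative open_U) force
  have k: "mink (E u) (D2X u x y) = k u * mink (DX u x) (DX u y)" if u: "u \<in> U" for u x y
  proof -
    obtain c where c: "\<And>x y. mink (E u) (D2X u x y) = c * mink (DX u x) (DX u y)"
      using umb u unfolding umbilic_iff[OF E(1)] by blast
    then have "k u = c" using mink_DX_pos[OF u v] by (simp add: k_def)
    then show ?thesis using c by simp
  qed
  \<comment> \<open>The difference \<open>?z\<close> of the two sides is orthogonal to the tangent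
    space by umbilicity, and to \<open>X u\<close> and \<open>E u\<close> because the products of
    \<open>E\<close> with \<open>X\<close> and with itself are constant; hence it is zero.\<close>
  have DE: "?DE u x = - k u *\<^sub>R DX u x" if u: "u \<in> U" for u x
  proof -
    have XE: "mink (X u) (X u) \<noteq> 0" "mink (E u) (E u) \<noteq> 0" "mink (X u) (E u) = 0"
      using R E(2,3)[OF u] by (simp_all add: mink_X_X[OF u] mink_commute[of "X u" "E u"])
    let ?z = "?DE u x + k u *\<^sub>R DX u x"
    have zT: "mink ?z (DX u y) = 0" for y
      using smooth_normal_fieldD(3)[OF E(1) u, where x = x and y = y] k[OF u, where x = x and y = y]
      by (simp add: mink.add_left mink.scaleR_left)
    have zX: "mink ?z (X u) = 0"
      using mink_derivative_const[OF E(4) smooth_X E(2) u, of x] E(5)[OF u, of x] mink_X_DX[OF u, of x]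
      by (simp add: mink.add_left mink.scaleR_left mink_commute[of "DX u x" "X u"])
    have zE: "mink ?z (E u) = 0"
      using mink_derivative_const[OF E(4) E(4) E(3) u, of x] E(5)[OF u, of x]
      by (simp add: mink.add_left mink.scaleR_left mink_commute[of "DX u x" "E u"] mink_commute[of "E u" "?DE u x"])
    have "?z = 0"
      using normal_expansion[OF u mink_X_DX[OF u] XE(1) E(5)[OF u] XE(2,3) zT] zX zE by simp
    then show ?thesis by (simp add: eq_neg_iff_add_eq_0)
  qed
  have D2E: "frechet_derivative (\<lambda>u. ?DE u y) (at u) x
      = - (k u *\<^sub>R D2X u x y + frechet_derivative k (at u) x *\<^sub>R DX u y)" if u: "u \<in> U" for u x y
  proof -
    have "((\<lambda>u. - (k u *\<^sub>R DX u y)) has_derivative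
        (\<lambda>x. - (k u *\<^sub>R D2X u x y + frechet_derivative k (at u) x *\<^sub>R DX u y))) (at u)"
      by (intro has_derivative_minus has_derivative_scaleR smooth_on_has_derivative[OF _ u] smk smooth_DX)
    then have "((\<lambda>u. ?DE u y) has_derivative
        (\<lambda>x. - (k u *\<^sub>R D2X u x y + frechet_derivative k (at u) x *\<^sub>R DX u y))) (at u)"
      by (rule has_derivative_transform_within_open[OF _ open_U u]) (simp add: DE)
    from fun_cong[OF frechet_derivative_at[OF this], of x, symmetric] show ?thesis .
  qed
  have Dk: "frechet_derivative k (at u) x = 0" if u: "u \<in> U" for u x
  proof (cases "x = 0")
    case True
    then show ?thesis
      using linear_0[OF has_derivative_linear[OF smooth_on_has_derivative[OF smk u]]] by simp
  next
    case False
    \<comment> \<open>Here the surface has dimension at least two, so some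
      \<open>y \<noteq> 0\<close> is orthogonal to \<open>x\<close>. Symmetry of the second
      derivative of \<open>E\<close> gives \<open>?a *\<^sub>R DX u y = ?b *\<^sub>R DX u x\<close>,
      and independence forces \<open>?a = 0\<close>.\<close>
    have "dim {x} < DIM(real^'m)"
      using dim_le_card'[of "{x}"] dim codim by simp
    then obtain y where y: "y \<noteq> 0" "orthogonal y x"
      using orthogonal_to_subspace_exists[of "{x}"] by (metis singletonI span_base)
    let ?a = "frechet_derivative k (at u) x" and ?b = "frechet_derivative k (at u) y"
    have "?a *\<^sub>R DX u y = ?b *\<^sub>R DX u x"
      using symmetric_second_derivative[OF open_U u E(4), of x y]
      unfolding D2E[OF u] D2X_commute[OF u, of x y] by simp
    then have "DX u (?a *\<^sub>R y - ?b *\<^sub>R x) = 0"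
      by (simp add: linear_diff[OF linear_DX[OF u]] linear_scale[OF linear_DX[OF u]])
    then have "?a *\<^sub>R y - ?b *\<^sub>R x = 0" using DX_eq_0_iff[OF u] by blast
    then have "y \<bullet> (?a *\<^sub>R y - ?b *\<^sub>R x) = 0" by simp
    then show ?thesis using y by (simp add: inner_diff_right orthogonal_def)
  qed
  define F where "F u = E u + k u *\<^sub>R X u" for u
  have DF: "(F has_derivative (\<lambda>x. 0)) (at u)" if u: "u \<in> U" for u
  proof -
    have "(F has_derivative (\<lambda>x. ?DE u x + (k u *\<^sub>R DX u x + frechet_derivative k (at u) x *\<^sub>R X u))) (at u)"
      unfolding F_def
      by (intro has_derivative_add has_derivative_scaleR smooth_on_has_derivative[OF _ u] smk smooth_X E(4))
    then show ?thesis by (simp add: DE[OF u] Dk[OF u])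
  qed
  have Fconst: "F u = F w" if "u \<in> U" "w \<in> U" for u w
    by (rule has_derivative_zero_unique_connected[OF open_U connected_U DF that])
  have kconst: "k u = k w" if "u \<in> U" "w \<in> U" for u w
  proof (rule has_derivative_zero_unique_connected[OF open_U connected_U _ that])
    show "(k has_derivative (\<lambda>x. 0)) (at u)" if "u \<in> U" for u
      using smooth_on_has_derivative[OF smk that] ext[of "frechet_derivative k (at u)" "\<lambda>x. 0"] Dk[OF that]
      by simp
  qed
  obtain w where w: "w \<in> U" using M by (auto simp: spacelike_surface_def)
  \<comment> \<open>Pairing with \<open>E w\<close> shows that the constant vector is a legitimate
    hyperplane normal.\<close>
  have "mink (F w) (E w) = 1"
    by (simp add: F_def mink.add_left mink.scaleR_left E(3)[OF w] mink_commute[of "X w" "E w"] E(2)[OF w])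
  then have "F w \<noteq> 0" by (auto simp: mink.zero_left)
  moreover have "X u \<in> hyperplane (F w) (- (R\<^sup>2 * k w))" if u: "u \<in> U" for u
  proof -
    have "mink (X u) (F u) = - (R\<^sup>2 * k u)"
      by (simp add: F_def mink.add_right mink.scaleR_right mink_X_X[OF u] mink_commute[of "X u" "E u"] E(2)[OF u])
    then show ?thesis using Fconst[OF u w] kconst[OF u w] by (simp add: hyperplane_def)
  qed
  ultimately show ?thesis by blast
qed

lemma hyperplane_imp_umbilic:
  assumes dS: "de_sitter_normal E"
    and N: "N \<noteq> 0" "X ` U \<subseteq> hyperplane N c"
  shows "umbilic U X E"
  unfolding umbilic_iff[OF de_sitter_normalD(1)[OF dS]]
proof
  note E = de_sitter_normalD[OF dS]
  have smN: "smooth_on U (\<lambda>u. N)" by (rule smooth_on_const[OF open_U])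
  have NX: "mink N (X u) = c" if "u \<in> U" for u
    using N(2) that by (auto simp: hyperplane_def mink_commute[of N "X u"])
  have ND: "mink N (DX u y) = 0" if "u \<in> U" for u y
    using mink_derivative_const[OF smN smooth_X NX that, of y] by (simp add: frechet_derivative_const mink.zero_left)
  have smnN: "smooth_normal_field (\<lambda>u. N)"
    using smN ND by (simp add: smooth_normal_field_def)
  have ND2: "mink N (D2X u x y) = 0" if "u \<in> U" for u x y
    using smooth_normal_fieldD(3)[OF smnN that, where x = x and y = y] by (simp add: frechet_derivative_const mink.zero_left)
  fix u assume u: "u \<in> U"
  have XE: "mink (X u) (X u) \<noteq> 0" "mink (E u) (E u) \<noteq> 0" "mink (X u) (E u) = 0"
    using R E(2,3)[OF u] by (simp_all add: mink_X_X[OF u] mink_commute[of "X u" "E u"])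
  obtain a b where ab: "N = a *\<^sub>R X u + b *\<^sub>R E u"
    using normal_expansion[OF u mink_X_DX[OF u] XE(1) E(5)[OF u] XE(2,3) ND[OF u]] by blast
  have eq: "b * mink (E u) (D2X u x y) = a * mink (DX u x) (DX u y)" for x y
    using ND2[OF u, where x = x and y = y] by (simp add: ab mink.add_left mink.scaleR_left mink_X_D2X[OF u])
  \<comment> \<open>If \<open>b\<close> were zero, positivity of the metric in \<open>eq\<close>
    would force \<open>a = 0\<close>, and then \<open>N = 0\<close>.\<close>
  have "b \<noteq> 0"
  proof
    assume "b = 0"
    obtain v :: "real^'m" where "v \<noteq> 0" by (metis axis_eq_0_iff zero_neq_one)
    then have "a = 0" using eq[of v v] mink_DX_pos[OF u, of v] \<open>b = 0\<close> by simp
    then show False using N(1) ab \<open>b = 0\<close> by simp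
  qed
  then have "mink (E u) (D2X u x y) = (a / b) * mink (DX u x) (DX u y)" for x y
    using eq[where x = x and y = y] by (simp add: field_simps)
  then show "\<exists>k. \<forall>x y. mink (E u) (D2X u x y) = k * mink (DX u x) (DX u y)" by blast
qed

end

theorem theorem4p5:
  fixes U :: "(real^'m::finite) set"
    and X :: "real^'m \<Rightarrow> 'n::finite mspace"
    and R :: real
  assumes dim: "CARD('n) \<ge> 3"
    and codim: "CARD('n) = CARD('m) + 1"
    and R: "R > 0"
    and M: "spacelike_surface U X"
    and sub: "X ` U \<subseteq> hyperbolic_plus 0 R"
  shows "((\<exists>r>0. \<exists>s. umbilic U X (normal_field U X r s)) \<longleftrightarrow> totally_umbilic U X)
       \<and> (totally_umbilic U X \<longleftrightarrow> (\<exists>N c. N \<noteq> 0 \<and> X ` U \<subseteq> hyperplane N c))"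
proof -
  interpret spacelike_in_hyperbolic U X R
    using assms by unfold_locales
  obtain E where E: "de_sitter_normal E" using exists_de_sitter_normal by blast
  have "umbilic U X (normal_field U X r s) \<longleftrightarrow> umbilic U X E" if "r > 0" for r s
    using umbilic_normal_field_iff[OF E that] .
  then have "(\<exists>r>0. \<exists>s. umbilic U X (normal_field U X r s)) \<longleftrightarrow> umbilic U X E"
    "totally_umbilic U X \<longleftrightarrow> umbilic U X E"
    unfolding totally_umbilic_def using zero_less_one by blast+
  moreover have "umbilic U X E \<longleftrightarrow> (\<exists>N c. N \<noteq> 0 \<and> X ` U \<subseteq> hyperplane N c)"
    using umbilic_imp_hyperplane[OF E] hyperplane_imp_umbilic[OF E] by blast
  ultimately show ?thesis by blast
qed

end
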